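(* There is a function $f\colon\omega\to\omega$ such that $f(n)\le K(n)$ for all $n$, $\sum_{n\in\omega}2^{-f(n)}<\infty$, and $f$ does not have PA degree.
   Context: $K$ denotes prefix-free Kolmogorov complexity, viewed as a function on $\omega$ by identifying binary strings with natural numbers via the length-lexicographic ordering. An oracle (or function) has PA degree if it computes a path through every nonempty $\Pi^0_1$ subclass of $2^\omega$; equivalently, it computes a $\{0,1\}$-valued diagonally noncomputable function. *)

theory Defs
  imports Complex_Main "HOL-Library.Nat_Bijection" "HOL-Library.Sublist" "HOL-Library.Extended_Nat"
begin

text \<open>
  Binary strings are identified with natural numbers by reading them as bijective base-2
  numerals (digits 1 and 2, most significant digit first). By \<open>bij_nat_of_string\<close> and
  \<open>nat_of_string_less_iff\<close> this is the enumeration of the strings in length-lexicographic order.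
\<close>

primrec nat_of_string :: "bool list \<Rightarrow> nat" where
  "nat_of_string [] = 0"
| "nat_of_string (b # s) = (if b then 2 else 1) * 2 ^ length s + nat_of_string s"

definition string_of_nat :: "nat \<Rightarrow> bool list" where
  "string_of_nat = inv nat_of_string"

lemma nat_of_string_bounds:
  "2 ^ length s \<le> Suc (nat_of_string s)" "Suc (nat_of_string s) < 2 ^ Suc (length s)"
  by (induction s) auto

lemma nat_of_string_less_same_length:
  assumes "length s = length t"
  shows "nat_of_string s < nat_of_string t \<longleftrightarrow> (s, t) \<in> lex {(False, True)}"
  using assms
proof (induction s t rule: list_induct2)
  case Nil
  then show ?case by simp
next
  case (Cons a s b t)
  show ?case
    using Cons nat_of_string_bounds[of s] nat_of_string_bounds[of t] by (cases a; cases b) auto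
qed

lemma nat_of_string_less_iff:
  "nat_of_string s < nat_of_string t \<longleftrightarrow> (s, t) \<in> lenlex {(False, True)}"
proof -
  have aux: "nat_of_string u < nat_of_string v" if "length u < length v" for u v
  proof -
    have "(2::nat) ^ Suc (length u) \<le> 2 ^ length v"
      using that by (intro power_increasing) auto
    then show ?thesis
      using nat_of_string_bounds(2)[of u] nat_of_string_bounds(1)[of v] by linarith
  qed
  show ?thesis
    using aux[of s t] aux[of t s] nat_of_string_less_same_length[of s t]
    by (cases "length s" "length t" rule: linorder_cases) (auto simp: lenlex_conv)
qed

lemma nat_of_string_snoc:
  "nat_of_string (s @ [b]) = 2 * nat_of_string s + (if b then 2 else 1)"
  by (induction s) auto

lemma bij_nat_of_string: "bij nat_of_string"
proof (rule bijI)
  show "inj nat_of_string"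
  proof (rule injI)
    fix s t assume eq: "nat_of_string s = nat_of_string t"
    have "total (lenlex {(False, True)})"
      by (rule total_lenlex) (auto simp: total_on_def)
    then show "s = t"
      using eq nat_of_string_less_iff[of s t] nat_of_string_less_iff[of t s]
      by (auto simp: total_on_def)
  qed
  have "\<exists>s. nat_of_string s = n" for n
  proof (induction n rule: less_induct)
    case (less n)
    show ?case
    proof (cases "n = 0")
      case True
      then have "nat_of_string [] = n" by simp
      then show ?thesis by blast
    next
      case False
      then obtain s where s: "nat_of_string s = (n - 1) div 2"
        using less[of "(n - 1) div 2"] by fastforce
      have "nat_of_string (s @ [even n]) = n"
        unfolding nat_of_string_snoc s using False by (auto elim!: evenE oddE)
      then show ?thesis by blast
    qed
  qed
  then show "surj nat_of_string" by (metis surjI)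
qed

text \<open>
  The partial functions that are partial recursive relative to the total functions in \<open>F\<close>. They are
  unary; several arguments are coded by the Cantor pairing function.
\<close>

definition mu_op :: "(nat \<Rightarrow> nat option) \<Rightarrow> nat option" where
  "mu_op p =
    (if \<exists>m. p m = Some 0 \<and> (\<forall>k<m. p k \<noteq> None)
     then Some (LEAST m. p m = Some 0) else None)"

inductive partrec_in :: "(nat \<Rightarrow> nat) set \<Rightarrow> (nat \<Rightarrow> nat option) \<Rightarrow> bool"
  for F :: "(nat \<Rightarrow> nat) set" where
  zero: "partrec_in F (\<lambda>n. Some 0)"
| succ: "partrec_in F (\<lambda>n. Some (Suc n))"
| left: "partrec_in F (\<lambda>n. Some (fst (prod_decode n)))"
| right: "partrec_in F (\<lambda>n. Some (snd (prod_decode n)))"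
| query: "f \<in> F \<Longrightarrow> partrec_in F (\<lambda>n. Some (f n))"
| pair: "partrec_in F p \<Longrightarrow> partrec_in F q \<Longrightarrow>
    partrec_in F (\<lambda>n. Option.bind (p n) (\<lambda>a. Option.bind (q n) (\<lambda>b. Some (prod_encode (a, b)))))"
| comp: "partrec_in F p \<Longrightarrow> partrec_in F q \<Longrightarrow> partrec_in F (\<lambda>n. Option.bind (q n) p)"
| prec: "partrec_in F p \<Longrightarrow> partrec_in F q \<Longrightarrow>
    partrec_in F (\<lambda>n. case prod_decode n of (a, m) \<Rightarrow>
      rec_nat (p a) (\<lambda>k r. Option.bind r (\<lambda>i. q (prod_encode (a, prod_encode (k, i))))) m)"
| mu: "partrec_in F p \<Longrightarrow> partrec_in F (\<lambda>a. mu_op (\<lambda>m. p (prod_encode (a, m))))"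

definition computes :: "(nat \<Rightarrow> nat) \<Rightarrow> (nat \<Rightarrow> bool) \<Rightarrow> bool" where
  "computes f X \<longleftrightarrow> partrec_in {f} (\<lambda>n. Some (of_bool (X n)))"

definition computable_string_set :: "bool list set \<Rightarrow> bool" where
  "computable_string_set T \<longleftrightarrow> partrec_in {} (\<lambda>n. Some (of_bool (string_of_nat n \<in> T)))"

definition partial_computable_string_fun :: "(bool list \<Rightarrow> bool list option) \<Rightarrow> bool" where
  "partial_computable_string_fun M \<longleftrightarrow>
    partrec_in {} (\<lambda>n. map_option nat_of_string (M (string_of_nat n)))"

definition prefix_free_machine :: "(bool list \<Rightarrow> bool list option) \<Rightarrow> bool" where
  "prefix_free_machine M \<longleftrightarrow> partial_computable_string_fun M \<and>
    (\<forall>\<sigma>\<in>dom M. \<forall>\<tau>\<in>dom M. prefix \<sigma> \<tau> \<longrightarrow> \<sigma> = \<tau>)"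

definition machine_complexity :: "(bool list \<Rightarrow> bool list option) \<Rightarrow> bool list \<Rightarrow> enat" where
  "machine_complexity M \<sigma> = (INF \<tau> \<in> {\<tau>. M \<tau> = Some \<sigma>}. enat (length \<tau>))"

definition optimal_prefix_free_machine :: "(bool list \<Rightarrow> bool list option) \<Rightarrow> bool" where
  "optimal_prefix_free_machine U \<longleftrightarrow> prefix_free_machine U \<and>
    (\<forall>M. prefix_free_machine M \<longrightarrow>
      (\<exists>c::nat. \<forall>\<sigma>. machine_complexity U \<sigma> \<le> machine_complexity M \<sigma> + enat c))"

text \<open>
  Prefix-free complexity of natural numbers with respect to the reference machine \<open>U\<close>, which is
  meant to be an optimal prefix-free machine (its values are then all finite).
\<close>

definition prefix_K :: "(bool list \<Rightarrow> bool list option) \<Rightarrow> nat \<Rightarrow> enat" where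
  "prefix_K U n = machine_complexity U (string_of_nat n)"

definition is_tree :: "bool list set \<Rightarrow> bool" where
  "is_tree T \<longleftrightarrow> (\<forall>\<tau>\<in>T. \<forall>\<sigma>. prefix \<sigma> \<tau> \<longrightarrow> \<sigma> \<in> T)"

definition paths :: "bool list set \<Rightarrow> (nat \<Rightarrow> bool) set" where
  "paths T = {X. \<forall>n. map X [0..<n] \<in> T}"

definition Pi01_class :: "(nat \<Rightarrow> bool) set \<Rightarrow> bool" where
  "Pi01_class P \<longleftrightarrow> (\<exists>T. is_tree T \<and> computable_string_set T \<and> P = paths T)"

definition has_PA_degree :: "(nat \<Rightarrow> nat) \<Rightarrow> bool" where
  "has_PA_degree f \<longleftrightarrow> (\<forall>P. Pi01_class P \<and> P \<noteq> {} \<longrightarrow> (\<exists>X\<in>P. computes f X))"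

end

theory Submission
  imports Defs "HOL-Library.Countable"
begin

text \<open>
  The \<open>\<Pi>\<^sup>0\<^sub>1\<close> class avoided by \<open>f\<close> consists of the sets that separate two disjoint c.e. sets read
  off from the reference machine: for a triple \<open>(k, n, m)\<close>, a separator tells which of \<open>n\<close>, \<open>m\<close> is not
  the first to be seen to have complexity at most \<open>k\<close>. A computable separator would let a knockout
  tournament among \<open>2 ^ Suc k + 1\<close> numbers compute from \<open>k\<close> a number of complexity above \<open>k\<close>,
  against optimality.

  The function \<open>f\<close> is built by forcing. A condition \<open>(g, l, e)\<close> fixes \<open>f\<close> below \<open>l\<close>, demands
  \<open>f \<le> g\<close>, and bounds the sum of \<open>2 ^ - f n\<close> over \<open>n \<ge> l\<close> by \<open>e\<close>; initially \<open>g\<close> is the minimum of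
  complexity and identity, whose weight is finite by Kraft's inequality. Let \<open>c\<close> be an oracle
  program. Answer \<open>i\<close> at \<open>x\<close> is called large if it is given by some light oracle below every upper
  bound of small weight. By compactness, an answer that is not large can be excluded by lowering \<open>g\<close> at
  a small cost in weight, and largeness is witnessed by a finite computation. So either both answers
  at some \<open>x\<close> can be excluded, or a large answer can be computed from each \<open>x\<close>; the latter is wrong
  at some \<open>x\<close>, because no separator is computable, and then \<open>f\<close> can be extended so that \<open>c\<close> gives
  this wrong answer.
\<close>

subsection \<open>Closure properties of computable functions\<close>

definition computable :: "(nat \<Rightarrow> nat) \<Rightarrow> bool" where
  "computable g \<longleftrightarrow> partrec_in {} (\<lambda>n. Some (g n))"

definition decidable :: "(nat \<Rightarrow> bool) \<Rightarrow> bool" where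
  "decidable P \<longleftrightarrow> computable (\<lambda>n. of_bool (P n))"

definition lproj :: "nat \<Rightarrow> nat" where "lproj n = fst (prod_decode n)"
definition rproj :: "nat \<Rightarrow> nat" where "rproj n = snd (prod_decode n)"

lemma proj_pair [simp]: "lproj (prod_encode (a, b)) = a" "rproj (prod_encode (a, b)) = b"
  by (simp_all add: lproj_def rproj_def)

named_theorems computable_intros

lemma computable_comp:
  assumes "computable f" "computable g" shows "computable (\<lambda>x. f (g x))"
  using partrec_in.comp[OF assms[unfolded computable_def]] by (simp add: computable_def)

text \<open>The identity is not among the basic functions, but pairing the two projections gives it
  back.\<close>

lemma computable_id [computable_intros]: "computable (\<lambda>x. x)"
  using partrec_in.pair[OF partrec_in.left partrec_in.right, of "{}"] by (simp add: computable_def)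

lemma computable_Suc [computable_intros]: "computable f \<Longrightarrow> computable (\<lambda>x. Suc (f x))"
  by (rule computable_comp[of Suc]) (simp add: computable_def partrec_in.succ)

lemma computable_const [computable_intros]: "computable (\<lambda>x. c)"
  by (induction c) (auto simp: computable_def[of "\<lambda>x. 0"] intro: partrec_in.zero computable_Suc)

lemma computable_lproj [computable_intros]: "computable f \<Longrightarrow> computable (\<lambda>x. lproj (f x))"
  by (rule computable_comp[of lproj]) (simp add: computable_def lproj_def partrec_in.left)

lemma computable_rproj [computable_intros]: "computable f \<Longrightarrow> computable (\<lambda>x. rproj (f x))"
  by (rule computable_comp[of rproj]) (simp add: computable_def rproj_def partrec_in.right)

lemma computable_pair [computable_intros]:
  assumes "computable f" "computable g" shows "computable (\<lambda>x. prod_encode (f x, g x))"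
  using partrec_in.pair[OF assms[unfolded computable_def]] by (simp add: computable_def)

text \<open>Applying \<open>prec\<close> to \<open>prod_encode (x, m x)\<close> lets base, step and
  count all depend on \<open>x\<close>. The step is presented as a function of one coded triple
  \<open>(x, k, r)\<close>, so that \<open>computable_intros\<close> can handle it.\<close>

lemma computable_rec_nat [computable_intros]:
  assumes b: "computable b" and m: "computable m"
    and s: "computable (\<lambda>y. s (lproj y) (lproj (rproj y)) (rproj (rproj y)))"
  shows "computable (\<lambda>x. rec_nat (b x) (s x) (m x))"
proof -
  have rec: "rec_nat (Some (b a)) (\<lambda>k r. Option.bind r (\<lambda>i. Some (s a k i))) j
      = Some (rec_nat (b a) (s a) j)" for a j
    by (induction j) auto
  have "computable (\<lambda>n. rec_nat (b (lproj n)) (s (lproj n)) (rproj n))"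
    using partrec_in.prec[OF b[unfolded computable_def] s[unfolded computable_def]]
    by (simp add: computable_def rec case_prod_beta flip: lproj_def rproj_def)
  from computable_comp[OF this computable_pair[OF computable_id m]] show ?thesis by simp
qed

lemma computable_Least:
  assumes P: "decidable (\<lambda>y. P (lproj y) (rproj y))" and ex: "\<And>x. \<exists>m. P x m"
  shows "computable (\<lambda>x. LEAST m. P x m)"
proof -
  \<comment> \<open>This recursion swaps 0 and 1, since \<open>mu\<close> searches for a zero rather
    than for a true value.\<close>
  have "computable (\<lambda>y. rec_nat 1 (\<lambda>_ _. 0) (of_bool (P (lproj y) (rproj y))))"
    using P unfolding decidable_def by (intro computable_intros)
  moreover have "rec_nat 1 (\<lambda>_ _. 0) (of_bool Q) = (of_bool (\<not> Q) :: nat)" for Q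
    by (cases Q) auto
  ultimately have "computable (\<lambda>y. of_bool (\<not> P (lproj y) (rproj y)))" by simp
  from partrec_in.mu[OF this[unfolded computable_def]]
  have "partrec_in {} (\<lambda>a. mu_op (\<lambda>m. Some (of_bool (\<not> P a m))))" by simp
  moreover have "mu_op (\<lambda>m. Some (of_bool (\<not> P a m))) = Some (LEAST m. P a m)" for a
    using ex[of a] by (auto simp: mu_op_def)
  ultimately show ?thesis by (simp add: computable_def)
qed

lemma computable_add [computable_intros]:
  assumes "computable f" "computable g" shows "computable (\<lambda>x. f x + g x)"
proof -
  have "computable (\<lambda>x. rec_nat (f x) (\<lambda>k r. Suc r) (g x))"
    using assms by (intro computable_intros)
  moreover have "rec_nat a (\<lambda>k r. Suc r) b = a + b" for a b by (induction b) auto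
  ultimately show ?thesis by simp
qed

lemma computable_mult [computable_intros]:
  assumes "computable f" "computable g" shows "computable (\<lambda>x. f x * g x)"
proof -
  have "computable (\<lambda>x. rec_nat 0 (\<lambda>k r. f x + r) (g x))"
    using assms(2) by (intro computable_intros computable_comp[OF assms(1)])
  moreover have "rec_nat 0 (\<lambda>k r. a + r) b = a * b" for a b by (induction b) auto
  ultimately show ?thesis by simp
qed

lemma computable_diff [computable_intros]:
  assumes "computable f" "computable g" shows "computable (\<lambda>x. f x - g x)"
proof -
  \<comment> \<open>The inner recursion is the predecessor, with value 0 at 0; iterating it gives
    truncated subtraction.\<close>
  have "computable (\<lambda>x. rec_nat (f x) (\<lambda>k r. rec_nat 0 (\<lambda>i _. i) r) (g x))"
    using assms by (intro computable_intros)
  moreover have "rec_nat 0 (\<lambda>i _. i) b = b - 1" for b by (cases b) auto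
  moreover have "rec_nat a (\<lambda>k r. r - Suc 0) b = a - b" for a b by (induction b) auto
  ultimately show ?thesis by simp
qed

lemma computable_power [computable_intros]:
  assumes "computable f" "computable g" shows "computable (\<lambda>x. f x ^ g x)"
proof -
  have "computable (\<lambda>x. rec_nat 1 (\<lambda>k r. f x * r) (g x))"
    using assms(2) by (intro computable_intros computable_comp[OF assms(1)])
  moreover have "rec_nat 1 (\<lambda>k r. a * r) b = a ^ b" for a b :: nat by (induction b) auto
  ultimately show ?thesis by simp
qed

lemma computable_of_bool [computable_intros]: "decidable P \<Longrightarrow> computable (\<lambda>x. of_bool (P x))"
  by (simp add: decidable_def)

section \<open>Decidable predicates and bounded quantifiers\<close>

lemma decidable_not [computable_intros]:
  assumes "decidable P" shows "decidable (\<lambda>x. \<not> P x)"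
proof -
  have "computable (\<lambda>x. 1 - of_bool (P x))" using assms by (intro computable_intros)
  moreover have "1 - of_bool Q = (of_bool (\<not> Q) :: nat)" for Q by auto
  ultimately show ?thesis by (simp add: decidable_def)
qed

lemma decidable_conj [computable_intros]:
  assumes "decidable P" "decidable Q" shows "decidable (\<lambda>x. P x \<and> Q x)"
  using computable_mult[OF assms[unfolded decidable_def]] by (simp add: decidable_def of_bool_conj)

lemma decidable_disj [computable_intros]:
  assumes "decidable P" "decidable Q" shows "decidable (\<lambda>x. P x \<or> Q x)"
  using decidable_not[OF decidable_conj[OF assms[THEN decidable_not]]] by simp

lemma decidable_imp [computable_intros]:
  assumes "decidable P" "decidable Q" shows "decidable (\<lambda>x. P x \<longrightarrow> Q x)"
  unfolding imp_conv_disj by (intro decidable_disj decidable_not assms)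

lemma decidable_le [computable_intros]:
  assumes "computable f" "computable g" shows "decidable (\<lambda>x. f x \<le> g x)"
proof -
  have "computable (\<lambda>x. 1 - (f x - g x))" using assms by (intro computable_intros)
  moreover have "1 - (a - b) = of_bool (a \<le> b)" for a b :: nat by auto
  ultimately show ?thesis by (simp add: decidable_def)
qed

lemma decidable_less [computable_intros]:
  "computable f \<Longrightarrow> computable g \<Longrightarrow> decidable (\<lambda>x. f x < g x)"
  using decidable_le[of "\<lambda>x. Suc (f x)" g] by (simp add: computable_Suc Suc_le_eq)

lemma decidable_eq [computable_intros]:
  "computable f \<Longrightarrow> computable g \<Longrightarrow> decidable (\<lambda>x. f x = g x)"
  using decidable_conj[OF decidable_le[of f g] decidable_le[of g f]] by (simp add: order_eq_iff)

lemma computable_if [computable_intros]: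
  assumes "decidable P" "computable f" "computable g"
  shows "computable (\<lambda>x. if P x then f x else g x)"
proof -
  have "computable (\<lambda>x. of_bool (P x) * f x + of_bool (\<not> P x) * g x)"
    using assms by (intro computable_intros)
  moreover have "of_bool Q * a + of_bool (\<not> Q) * b = (if Q then a else b)" for Q and a b :: nat
    by auto
  ultimately show ?thesis by simp
qed

lemma computable_sum [computable_intros]:
  assumes "computable B" "computable (\<lambda>y. F (lproj y) (rproj y))"
  shows "computable (\<lambda>x. \<Sum>n<B x. F x n)"
proof -
  have "computable (\<lambda>y. F (lproj y) (lproj (rproj y)))"
    using computable_comp[OF assms(2), of "\<lambda>y. prod_encode (lproj y, lproj (rproj y))"]
    by (simp add: computable_intros)
  then have "computable (\<lambda>x. rec_nat 0 (\<lambda>k r. F x k + r) (B x))"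
    using assms by (intro computable_intros)
  moreover have "rec_nat 0 (\<lambda>k r. F x k + r) b = (\<Sum>n<b. F x n)" for x b
    by (induction b) auto
  ultimately show ?thesis by simp
qed

text \<open>The number of counterexamples is a bounded sum, and it can be compared with 0.\<close>

lemma decidable_ball [computable_intros]:
  assumes "computable B" "decidable (\<lambda>y. P (lproj y) (rproj y))"
  shows "decidable (\<lambda>x. \<forall>n<B x. P x n)"
proof -
  have "decidable (\<lambda>x. (\<Sum>n<B x. of_bool (\<not> P x n)) = (0::nat))"
    using assms by (intro computable_intros)
  moreover have "(\<Sum>n<B x. of_bool (\<not> P x n)) = (0::nat) \<longleftrightarrow> (\<forall>n<B x. P x n)" for x by auto
  ultimately show ?thesis by simp
qed

lemma decidable_bex [computable_intros]:
  assumes "computable B" "decidable (\<lambda>y. P (lproj y) (rproj y))"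
  shows "decidable (\<lambda>x. \<exists>n<B x. P x n)"
  using decidable_not[OF decidable_ball[OF assms(1) decidable_not[OF assms(2)]]] by simp

lemma computable_half [computable_intros]:
  assumes "computable f" shows "computable (\<lambda>x. f x div 2)"
proof -
  have "computable (\<lambda>x. LEAST q. x < 2 * Suc q)"
  proof (rule computable_Least)
    show "\<exists>m. x < 2 * Suc m" for x by (rule exI[of _ x]) auto
  qed (intro computable_intros)
  moreover have "(LEAST q. x < 2 * Suc q) = x div 2" for x by (rule Least_equality) auto
  ultimately show ?thesis using computable_comp assms by auto
qed

subsection \<open>Oracle programs with bounded resources\<close>

datatype prog = Zero | Succ | Lproj | Rproj | Query | Pair prog prog | Comp prog prog
  | Prec prog prog | Mu prog

text \<open>
  \<open>run f s c n\<close> is 0 if program \<open>c\<close> gives no output on \<open>n\<close> when oracle queries and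
  unbounded searches are cut off at \<open>s\<close>, and the successor of the output otherwise.
\<close>

primrec run :: "(nat \<Rightarrow> nat) \<Rightarrow> nat \<Rightarrow> prog \<Rightarrow> nat \<Rightarrow> nat" where
  "run f s Zero n = 1"
| "run f s Succ n = Suc (Suc n)"
| "run f s Lproj n = Suc (lproj n)"
| "run f s Rproj n = Suc (rproj n)"
| "run f s Query n = (if n < s then Suc (f n) else 0)"
| "run f s (Pair p q) n = (if run f s p n = 0 \<or> run f s q n = 0 then 0
     else Suc (prod_encode (run f s p n - 1, run f s q n - 1)))"
| "run f s (Comp p q) n = (if run f s q n = 0 then 0 else run f s p (run f s q n - 1))"
| "run f s (Prec p q) n = rec_nat (run f s p (lproj n))
     (\<lambda>k r. if r = 0 then 0 else run f s q (prod_encode (lproj n, prod_encode (k, r - 1))))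
     (rproj n)"
| "run f s (Mu p) n =
     (if \<exists>m<s. run f s p (prod_encode (n, m)) = 1 \<and> (\<forall>k<m. run f s p (prod_encode (n, k)) > 1)
      then Suc (LEAST m. m = s \<or> run f s p (prod_encode (n, m)) = 1) else 0)"

text \<open>The use principle: only queries below \<open>s\<close> are answered, so values of the
  oracle from \<open>s\<close> on cannot matter.\<close>

lemma run_cong:
  assumes "\<And>n. n < s \<Longrightarrow> f n = g n" shows "run f s c n = run g s c n"
proof -
  have "run f s c = run g s c"
  proof (induction c)
    case (Prec p q)
    show ?case unfolding fun_eq_iff run.simps Prec by blast
  next
    case (Mu p)
    show ?case unfolding fun_eq_iff run.simps Mu by blast
  qed (simp_all add: fun_eq_iff assms)
  then show ?thesis by simp
qed

lemma run_Prec_pair: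
  "run f s (Prec p q) (prod_encode (a, 0)) = run f s p a"
  "run f s (Prec p q) (prod_encode (a, Suc m)) =
     (let r = run f s (Prec p q) (prod_encode (a, m)) in
      if r = 0 then 0 else run f s q (prod_encode (a, prod_encode (m, r - 1))))"
  unfolding run.simps proj_pair by (simp_all add: Let_def)

lemma run_Mu_eq:
  assumes "m < s" "run f s p (prod_encode (n, m)) = 1"
    and "\<And>k. k < m \<Longrightarrow> run f s p (prod_encode (n, k)) > 1"
  shows "run f s (Mu p) n = Suc m"
proof -
  have "(LEAST m. m = s \<or> run f s p (prod_encode (n, m)) = 1) = m"
  proof (rule Least_equality)
    fix y assume "y = s \<or> run f s p (prod_encode (n, y)) = 1"
    then show "m \<le> y" using assms(1) assms(3)[of y] by (cases "y < m") auto
  qed (use assms in simp)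
  then show ?thesis using assms by auto
qed

text \<open>A successful search has seen converging values at all smaller arguments, so a higher
  cut-off cannot reveal an earlier zero.\<close>

lemma run_mono:
  assumes "s \<le> t" "run f s c n \<noteq> 0" shows "run f t c n = run f s c n"
  using assms(2)
proof (induction c arbitrary: n)
  case (Pair p q)
  then show ?case by (auto split: if_splits)
next
  case (Comp p q)
  then show ?case by (auto split: if_splits)
next
  case (Prec p q)
  let ?R = "\<lambda>s. rec_nat (run f s p (lproj n))
     (\<lambda>k r. if r = 0 then 0 else run f s q (prod_encode (lproj n, prod_encode (k, r - 1))))"
  have "?R s j \<noteq> 0 \<Longrightarrow> ?R t j = ?R s j" for j
    by (induction j) (auto simp: Prec.IH split: if_splits)
  then show ?case using Prec.prems by simp
next
  case (Mu p)
  from Mu.prems obtain m where m: "m < s" "run f s p (prod_encode (n, m)) = 1"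
    "\<And>k. k < m \<Longrightarrow> run f s p (prod_encode (n, k)) > 1" by (auto split: if_splits)
  have "run f s (Mu p) n = Suc m" using m by (rule run_Mu_eq)
  moreover have "run f t (Mu p) n = Suc m"
  proof (rule run_Mu_eq)
    show "m < t" using m assms(1) by simp
    show "run f t p (prod_encode (n, m)) = 1" using m Mu.IH by auto
    show "run f t p (prod_encode (n, k)) > 1" if "k < m" for k
      using m(3)[OF that] Mu.IH[of "prod_encode (n, k)"] by auto
  qed
  ultimately show ?case by simp
qed (use assms(1) in \<open>auto split: if_splits\<close>)

lemma run_mono_Suc: "run f s c n = Suc v \<Longrightarrow> s \<le> t \<Longrightarrow> run f t c n = Suc v"
  using run_mono[of s t f c n] by simp

text \<open>Induction on the derivation; the stages of subcomputations are merged by taking maxima.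
  The form \<open>F \<subseteq> {f}\<close> covers both the reference machine, with
  \<open>F = {}\<close>, and computations from an oracle, with \<open>F = {f}\<close>.\<close>

lemma partrec_in_run:
  assumes "partrec_in F p" "F \<subseteq> {f}"
  shows "\<exists>c. \<forall>n v. p n = Some v \<longrightarrow> (\<exists>s. run f s c n = Suc v)"
  using assms
proof (induction rule: partrec_in.induct)
  case zero
  show ?case by (intro exI[of _ Zero]) auto
next
  case succ
  show ?case by (intro exI[of _ Succ]) auto
next
  case left
  show ?case by (intro exI[of _ Lproj]) (auto simp: lproj_def)
next
  case right
  show ?case by (intro exI[of _ Rproj]) (auto simp: rproj_def)
next
  case (query h)
  then have "run f (Suc n) Query n = Suc (h n)" for n by auto
  then show ?case by (intro exI[of _ Query]) blast
next
  case (pair p q)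
  then obtain c d where c: "\<And>n v. p n = Some v \<Longrightarrow> \<exists>s. run f s c n = Suc v"
    and d: "\<And>n v. q n = Some v \<Longrightarrow> \<exists>s. run f s d n = Suc v" by blast
  have "\<exists>s. run f s (Pair c d) n = Suc (prod_encode (a, b))" if ab: "p n = Some a" "q n = Some b" for n a b
  proof -
    obtain s t where st: "run f s c n = Suc a" "run f t d n = Suc b" using c d ab by blast
    have "run f (max s t) c n = Suc a" "run f (max s t) d n = Suc b"
      by (rule st[THEN run_mono_Suc], simp)+
    then show ?thesis by (intro exI[of _ "max s t"]) simp
  qed
  then show ?case by (intro exI[of _ "Pair c d"]) (auto simp: bind_eq_Some_conv simp del: run.simps)
next
  case (comp p q)
  then obtain c d where c: "\<And>n v. p n = Some v \<Longrightarrow> \<exists>s. run f s c n = Suc v"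
    and d: "\<And>n v. q n = Some v \<Longrightarrow> \<exists>s. run f s d n = Suc v" by blast
  have "\<exists>s. run f s (Comp c d) n = Suc b" if ab: "q n = Some a" "p a = Some b" for n a b
  proof -
    obtain s t where st: "run f s d n = Suc a" "run f t c a = Suc b" using c d ab by blast
    have "run f (max s t) d n = Suc a" "run f (max s t) c a = Suc b"
      by (rule st[THEN run_mono_Suc], simp)+
    then show ?thesis by (intro exI[of _ "max s t"]) simp
  qed
  then show ?case by (intro exI[of _ "Comp c d"]) (auto simp: bind_eq_Some_conv simp del: run.simps)
next
  case (prec p q)
  then obtain c d where c: "\<And>n v. p n = Some v \<Longrightarrow> \<exists>s. run f s c n = Suc v"
    and d: "\<And>n v. q n = Some v \<Longrightarrow> \<exists>s. run f s d n = Suc v" by blast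
  let ?r = "\<lambda>a m. rec_nat (p a) (\<lambda>k r. Option.bind r (\<lambda>i. q (prod_encode (a, prod_encode (k, i))))) m"
  have "\<exists>s. run f s (Prec c d) (prod_encode (a, m)) = Suc v" if "?r a m = Some v" for a m v
    using that
  proof (induction m arbitrary: v)
    case 0
    then show ?case using c[of a v] by auto
  next
    case (Suc m)
    then obtain i where i: "?r a m = Some i" "q (prod_encode (a, prod_encode (m, i))) = Some v"
      by (auto simp: bind_eq_Some_conv)
    then obtain s t where st: "run f s (Prec c d) (prod_encode (a, m)) = Suc i"
      "run f t d (prod_encode (a, prod_encode (m, i))) = Suc v" using Suc.IH d by blast
    have "run f (max s t) (Prec c d) (prod_encode (a, m)) = Suc i"
      "run f (max s t) d (prod_encode (a, prod_encode (m, i))) = Suc v"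
      by (rule st[THEN run_mono_Suc], simp)+
    then show ?case by (intro exI[of _ "max s t"]) (simp add: run_Prec_pair del: run.simps)
  qed
  then have "\<exists>s. run f s (Prec c d) n = Suc v"
    if "?r (fst (prod_decode n)) (snd (prod_decode n)) = Some v" for n v
    using that by (metis prod.collapse prod_decode_inverse)
  then show ?case by (intro exI[of _ "Prec c d"]) (simp add: case_prod_beta del: run.simps)
next
  case (mu p)
  then obtain c where c: "\<And>n v. p n = Some v \<Longrightarrow> \<exists>s. run f s c n = Suc v" by blast
  have "\<exists>s. run f s (Mu c) a = Suc v" if v: "mu_op (\<lambda>m. p (prod_encode (a, m))) = Some v" for a v
  proof -
    let ?P = "\<lambda>m. p (prod_encode (a, m)) = Some 0"
    from v obtain m where m: "?P m" "\<forall>k<m. p (prod_encode (a, k)) \<noteq> None" "v = (LEAST m. ?P m)"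
      by (auto simp: mu_op_def split: if_splits)
    have v0: "?P v" and vm: "v \<le> m" using m LeastI[of ?P m] Least_le[of ?P m] by auto
    have vl: "\<exists>i>0. p (prod_encode (a, k)) = Some i" if "k < v" for k
    proof -
      have "\<not> ?P k" using that m(3) not_less_Least[of k ?P] by blast
      moreover have "p (prod_encode (a, k)) \<noteq> None" using m(2) vm that by simp
      ultimately show ?thesis by auto
    qed
    have "\<forall>k. \<exists>s. k \<le> v \<longrightarrow> run f s c (prod_encode (a, k)) = Suc (the (p (prod_encode (a, k))))"
    proof
      fix k
      show "\<exists>s. k \<le> v \<longrightarrow> run f s c (prod_encode (a, k)) = Suc (the (p (prod_encode (a, k))))"
      proof (cases "k \<le> v")
        case True
        then obtain i where "p (prod_encode (a, k)) = Some i" using v0 vl[of k] le_less by blast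
        then show ?thesis using c[of "prod_encode (a, k)" i] by simp
      qed simp
    qed
    then obtain S where S: "\<And>k. k \<le> v \<Longrightarrow>
        run f (S k) c (prod_encode (a, k)) = Suc (the (p (prod_encode (a, k))))" by metis
    \<comment> \<open>Large enough both for the search to reach \<open>v\<close> and for all values
      at arguments up to \<open>v\<close> to have converged.\<close>
    define s where "s = Suc v + Max (S ` {..v})"
    have s: "S k \<le> s" if "k \<le> v" for k
      using that by (auto simp: s_def intro!: trans_le_add2 le_SucI Max_ge)
    have R: "run f s c (prod_encode (a, k)) = Suc (the (p (prod_encode (a, k))))" if "k \<le> v" for k
      using run_mono_Suc[OF S[OF that] s[OF that]] .
    have "run f s (Mu c) a = Suc v"
    proof (rule run_Mu_eq)
      show "v < s" by (simp add: s_def)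
      show "run f s c (prod_encode (a, v)) = 1" using R[of v] v0 by simp
      show "run f s c (prod_encode (a, k)) > 1" if "k < v" for k
        using R[of k] vl[OF that] that by auto
    qed
    then show ?thesis by blast
  qed
  then show ?case by blast
qed

text \<open>For a fixed program, its structure builds \<open>run\<close> from closure operations.
  The oracle comes from a uniformly computable family \<open>D\<close>, so that later it can range
  over coded finite oracles.\<close>

lemma computable_run:
  assumes D: "computable (\<lambda>y. D (lproj y) (rproj y))"
    and "computable a" "computable b" "computable d"
  shows "computable (\<lambda>x. run (D (a x)) (b x) c (d x))"
proof -
  have D': "computable (\<lambda>x. D (a x) (b x))" if "computable a" "computable b" for a b
    using computable_comp[OF D computable_pair[OF that]] by simp
  have "computable (\<lambda>x. run (D (a x)) (b x) c (d x))"
    if "computable a" "computable b" "computable d" for a b d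
    using that
  proof (induction c arbitrary: a b d)
    case (Pair p q)
    show ?case unfolding run.simps
      by (intro computable_intros Pair.IH Pair.prems)
  next
    case (Comp p q)
    show ?case unfolding run.simps
      by (intro computable_intros Comp.IH Comp.prems)
  next
    case (Prec p q)
    show ?case unfolding run.simps
      by (intro computable_intros Prec.IH Prec.prems Prec.prems[THEN computable_comp])
  next
    case (Mu p)
    \<comment> \<open>The alternative \<open>m = b x\<close> makes this search total, as
      \<open>computable_Least\<close> demands.\<close>
    have L: "computable (\<lambda>x. LEAST m. m = b x \<or> run (D (a x)) (b x) p (prod_encode (d x, m)) = 1)"
      by (intro computable_Least computable_intros Mu.IH Mu.prems Mu.prems[THEN computable_comp]) auto
    show ?case unfolding run.simps
      by (intro computable_intros Mu.IH L Mu.prems Mu.prems[THEN computable_comp])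
  qed (unfold run.simps, (intro computable_intros D'; assumption)+)
  then show ?thesis using assms(2-4) by blast
qed

subsection \<open>Separating classes of the reference machine\<close>

lemma string_of_nat_inverse [simp]:
  "string_of_nat (nat_of_string s) = s" "nat_of_string (string_of_nat n) = n"
  using bij_nat_of_string
  by (simp_all add: string_of_nat_def bij_is_inj bij_is_surj surj_f_inv_f)

lemma computable_length_string [computable_intros]:
  assumes "computable f" shows "computable (\<lambda>x. length (string_of_nat (f x)))"
proof -
  have "(LEAST l. Suc n < 2 ^ Suc l) = length (string_of_nat n)" for n
  proof (rule Least_equality)
    show "Suc n < 2 ^ Suc (length (string_of_nat n))"
      using nat_of_string_bounds(2)[of "string_of_nat n"] by simp
    fix l assume l: "Suc n < 2 ^ Suc l"
    have "(2::nat) ^ length (string_of_nat n) \<le> Suc n"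
      using nat_of_string_bounds(1)[of "string_of_nat n"] by simp
    then have "(2::nat) ^ length (string_of_nat n) < 2 ^ Suc l" using l by linarith
    then show "length (string_of_nat n) \<le> l" by (simp add: power_strict_increasing_iff del: power_Suc)
  qed
  moreover have "computable (\<lambda>n. LEAST l. Suc n < 2 ^ Suc l)"
  proof (rule computable_Least)
    show "\<exists>l. Suc n < 2 ^ Suc l" for n
      using nat_of_string_bounds(2)[of "string_of_nat n"] by auto
  qed (intro computable_intros)
  ultimately show ?thesis using computable_comp assms by simp
qed

text \<open>By \<open>nat_of_string_snoc\<close>, deleting the last bit acts on codes as
  \<open>(r - 1) div 2\<close>.\<close>

lemma nat_of_string_take:
  "j \<le> length s \<Longrightarrow>
    nat_of_string (take (length s - j) s) = rec_nat (nat_of_string s) (\<lambda>_ r. (r - 1) div 2) j"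
proof (induction j)
  case (Suc j)
  define x where "x = length s - Suc j"
  have x: "x < length s" "length s - j = Suc x" using Suc.prems by (auto simp: x_def)
  have "nat_of_string (take x s) = (nat_of_string (take (Suc x) s) - 1) div 2"
    using x by (simp add: take_Suc_conv_app_nth nat_of_string_snoc)
  moreover have "nat_of_string (take (Suc x) s) = rec_nat (nat_of_string s) (\<lambda>_ r. (r - 1) div 2) j"
    using Suc.IH Suc.prems x(2) by simp
  ultimately show ?case unfolding x_def[symmetric] by simp
qed simp

text \<open>The initial segment ending with a given bit has an even code exactly if this bit is
  \<open>True\<close>.\<close>

lemma decidable_nth_string:
  assumes "computable f" "computable g"
  shows "decidable (\<lambda>x. g x < length (string_of_nat (f x)) \<and> string_of_nat (f x) ! g x)"
proof -
  define h where "h n x = rec_nat n (\<lambda>_ r. (r - 1) div 2) (length (string_of_nat n) - Suc x)" for n x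
  have "x < length (string_of_nat n) \<and> string_of_nat n ! x \<longleftrightarrow>
      x < length (string_of_nat n) \<and> h n x = 2 * (h n x div 2)" for n x
  proof (cases "x < length (string_of_nat n)")
    case True
    have "h n x = nat_of_string (take (Suc x) (string_of_nat n))"
      using True nat_of_string_take[of "length (string_of_nat n) - Suc x" "string_of_nat n"]
      by (simp add: h_def)
    then show ?thesis using True by (simp add: take_Suc_conv_app_nth nat_of_string_snoc)
  qed simp
  moreover have "decidable (\<lambda>x. g x < length (string_of_nat (f x)) \<and>
      h (f x) (g x) = 2 * (h (f x) (g x) div 2))"
    unfolding h_def using assms by (intro computable_intros)
  ultimately show ?thesis by simp
qed

text \<open>A string of length \<open>s\<close> is put in the tree if it respects what is known by
  stage \<open>s\<close>. Monotonicity in the stage closes the tree under prefixes.\<close>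

lemma Pi01_class_separators:
  assumes dec: "decidable (\<lambda>y. A (lproj y) (rproj y))" "decidable (\<lambda>y. B (lproj y) (rproj y))"
    and mono: "\<And>s t x. s \<le> t \<Longrightarrow> A s x \<Longrightarrow> A t x" "\<And>s t x. s \<le> t \<Longrightarrow> B s x \<Longrightarrow> B t x"
  shows "Pi01_class {X. \<forall>s x. (A s x \<longrightarrow> X x) \<and> (B s x \<longrightarrow> \<not> X x)}"
proof -
  define T where "T = {\<sigma>. \<forall>x<length \<sigma>. (A (length \<sigma>) x \<longrightarrow> \<sigma> ! x) \<and> (B (length \<sigma>) x \<longrightarrow> \<not> \<sigma> ! x)}"
  have "is_tree T"
    unfolding is_tree_def
  proof (intro ballI allI impI)
    fix \<tau> \<sigma> assume \<tau>: "\<tau> \<in> T" and "prefix \<sigma> \<tau>"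
    then obtain \<rho> where \<rho>: "\<tau> = \<sigma> @ \<rho>" by (auto simp: prefix_def)
    show "\<sigma> \<in> T"
      unfolding T_def
    proof (intro CollectI allI impI)
      fix x assume x: "x < length \<sigma>"
      then have "(A (length \<tau>) x \<longrightarrow> \<sigma> ! x) \<and> (B (length \<tau>) x \<longrightarrow> \<not> \<sigma> ! x)"
        using \<tau>[unfolded T_def mem_Collect_eq, rule_format, of x] \<rho> by (auto simp: nth_append)
      then show "(A (length \<sigma>) x \<longrightarrow> \<sigma> ! x) \<and> (B (length \<sigma>) x \<longrightarrow> \<not> \<sigma> ! x)"
        using mono[of "length \<sigma>" "length \<tau>" x] \<rho> by auto
    qed
  qed
  moreover have "computable_string_set T"
  proof -
    have AB: "decidable (\<lambda>x. A (a x) (b x))" "decidable (\<lambda>x. B (a x) (b x))"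
      if "computable a" "computable b" for a b
      using computable_comp[OF dec(1)[unfolded decidable_def] computable_pair[OF that]]
        computable_comp[OF dec(2)[unfolded decidable_def] computable_pair[OF that]]
      by (simp_all add: decidable_def)
    let ?l = "\<lambda>n. length (string_of_nat n)"
    have "decidable (\<lambda>n. \<forall>x<?l n. (A (?l n) x \<longrightarrow> x < ?l n \<and> string_of_nat n ! x) \<and>
        (B (?l n) x \<longrightarrow> \<not> (x < ?l n \<and> string_of_nat n ! x)))"
      by (intro decidable_ball decidable_conj decidable_imp AB decidable_nth_string decidable_not
          computable_intros)
    moreover have "string_of_nat n \<in> T \<longleftrightarrow> (\<forall>x<?l n. (A (?l n) x \<longrightarrow> x < ?l n \<and> string_of_nat n ! x) \<and>
        (B (?l n) x \<longrightarrow> \<not> (x < ?l n \<and> string_of_nat n ! x)))" for n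
      by (auto simp: T_def)
    ultimately show ?thesis by (simp add: computable_string_set_def decidable_def computable_def)
  qed
  moreover have "{X. \<forall>s x. (A s x \<longrightarrow> X x) \<and> (B s x \<longrightarrow> \<not> X x)} = paths T"
  proof (intro equalityI subsetI)
    fix X assume "X \<in> paths T"
    then have X: "map X [0..<n] \<in> T" for n by (simp add: paths_def)
    have "(A s x \<longrightarrow> X x) \<and> (B s x \<longrightarrow> \<not> X x)" for s x
      \<comment> \<open>This length reaches stage \<open>s\<close> and contains position
        \<open>x\<close>.\<close>
      using X[of "max s (Suc x)"] mono[of s "max s (Suc x)" x] by (auto simp: T_def)
    then show "X \<in> {X. \<forall>s x. (A s x \<longrightarrow> X x) \<and> (B s x \<longrightarrow> \<not> X x)}" by blast
  qed (auto simp: paths_def T_def)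
  ultimately show ?thesis unfolding Pi01_class_def by blast
qed

text \<open>
  The numbers output, by stage \<open>s\<close>, by one of the first \<open>2 ^ Suc k\<close> inputs, which
  include the codes of all strings of length at most \<open>k\<close>.
\<close>

definition enumerated :: "prog \<Rightarrow> nat \<Rightarrow> nat \<Rightarrow> nat \<Rightarrow> bool" where
  "enumerated u k s n \<longleftrightarrow> (\<exists>p<2 ^ Suc k. run (\<lambda>_. 0) s u p = Suc n)"

text \<open>The order of appearance is strict: if both numbers appear at the same stage, a separator
  is left free. Bounding \<open>t\<close> keeps the relation decidable.\<close>

definition earlier :: "prog \<Rightarrow> nat \<Rightarrow> nat \<Rightarrow> nat \<Rightarrow> nat \<Rightarrow> bool" where
  "earlier u s k n m \<longleftrightarrow> (\<exists>t<Suc s. enumerated u k t n \<and> \<not> enumerated u k t m)"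

definition fst_first :: "prog \<Rightarrow> nat \<Rightarrow> nat \<Rightarrow> bool" where
  "fst_first u s x = earlier u s (lproj x) (lproj (rproj x)) (rproj (rproj x))"

definition snd_first :: "prog \<Rightarrow> nat \<Rightarrow> nat \<Rightarrow> bool" where
  "snd_first u s x = earlier u s (lproj x) (rproj (rproj x)) (lproj (rproj x))"

definition separators :: "prog \<Rightarrow> (nat \<Rightarrow> bool) set" where
  "separators u = {X. \<forall>s x. (fst_first u s x \<longrightarrow> X x) \<and> (snd_first u s x \<longrightarrow> \<not> X x)}"

lemma enumerated_mono: "s \<le> t \<Longrightarrow> enumerated u k s n \<Longrightarrow> enumerated u k t n"
  unfolding enumerated_def using run_mono_Suc by blast

lemma earlier_mono: "s \<le> t \<Longrightarrow> earlier u s k n m \<Longrightarrow> earlier u t k n m"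
  unfolding earlier_def by (meson Suc_le_mono less_le_trans)

text \<open>Whatever is seen at the smaller of the two witnessing stages is still seen at the larger
  one.\<close>

lemma earlier_asym: "earlier u s k n m \<Longrightarrow> \<not> earlier u t k m n"
  unfolding earlier_def using enumerated_mono by (metis nat_le_linear)

lemma decidable_earlier [computable_intros]:
  assumes "computable a" "computable b" "computable c" "computable d"
  shows "decidable (\<lambda>x. earlier u (a x) (b x) (c x) (d x))"
  unfolding earlier_def enumerated_def
  by (intro computable_intros computable_run[where D="\<lambda>_ _. 0" and a="\<lambda>_. 0"] assms assms[THEN computable_comp])

lemma Pi01_class_separators_prog: "Pi01_class (separators u)"
  unfolding separators_def
proof (rule Pi01_class_separators)
  show "decidable (\<lambda>y. fst_first u (lproj y) (rproj y))"
    unfolding fst_first_def by (intro computable_intros)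
  show "decidable (\<lambda>y. snd_first u (lproj y) (rproj y))"
    unfolding snd_first_def by (intro computable_intros)
qed (unfold fst_first_def snd_first_def, (rule earlier_mono; assumption)+)

lemma separators_nonempty: "separators u \<noteq> {}"
proof -
  have "(\<lambda>x. \<exists>s. fst_first u s x) \<in> separators u"
    unfolding separators_def fst_first_def snd_first_def using earlier_asym by blast
  then show ?thesis by blast
qed

text \<open>Pigeonhole: each of the \<open>2 ^ Suc k\<close> inputs has at most one output, but
  \<open>2 ^ Suc k + 1\<close> numbers compete.\<close>

lemma not_all_enumerated: "\<exists>n\<le>2 ^ Suc k. \<forall>s. \<not> enumerated u k s n"
proof (rule ccontr)
  assume "\<not> ?thesis"
  then have "\<forall>n. \<exists>p. n \<le> 2 ^ Suc k \<longrightarrow> p < 2 ^ Suc k \<and> (\<exists>s. run (\<lambda>_. 0) s u p = Suc n)"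
    unfolding enumerated_def by blast
  then obtain P where P: "\<And>n. n \<le> 2 ^ Suc k \<Longrightarrow> P n < 2 ^ Suc k \<and> (\<exists>s. run (\<lambda>_. 0) s u (P n) = Suc n)"
    by metis
  have "inj_on P {..2 ^ Suc k}"
  proof (rule inj_onI)
    fix n m assume "n \<in> {..2 ^ Suc k}" "m \<in> {..2 ^ Suc k}" and eq: "P n = P m"
    then obtain s t where st: "run (\<lambda>_. 0) s u (P n) = Suc n" "run (\<lambda>_. 0) t u (P n) = Suc m"
      using P[of n] P[of m] by auto
    have "run (\<lambda>_. 0) (max s t) u (P n) = Suc n" "run (\<lambda>_. 0) (max s t) u (P n) = Suc m"
      by (rule st[THEN run_mono_Suc], simp)+
    then show "n = m" by simp
  qed
  moreover have "P ` {..2 ^ Suc k} \<subseteq> {..<2 ^ Suc k}" using P by auto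
  ultimately have "card {..2 ^ Suc k :: nat} \<le> card {..<2 ^ Suc k :: nat}"
    by (metis card_inj_on_le finite_lessThan)
  then show False by simp
qed

lemma no_computable_separator:
  assumes U: "optimal_prefix_free_machine U"
    and u: "\<And>n v. map_option nat_of_string (U (string_of_nat n)) = Some v \<Longrightarrow>
      \<exists>s. run (\<lambda>_. 0) s u n = Suc v"
    and i: "computable i"
  shows "\<exists>s x. (fst_first u s x \<and> i x \<noteq> 1) \<or> (snd_first u s x \<and> i x = 1)"
proof (rule ccontr)
  assume "\<not> ?thesis"
  then have sep: "fst_first u s x \<Longrightarrow> i x = 1" "snd_first u s x \<Longrightarrow> i x \<noteq> 1" for s x by auto
  \<comment> \<open>The champion among the numbers up to \<open>j\<close>: in each round it meets
    the next number, and the answer 1 of \<open>i\<close> makes the newcomer win. The invariant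
    \<open>ch\<close> below says that if the champion is ever enumerated, so are all the
    others.\<close>
  define ch where "ch k j = rec_nat 0
    (\<lambda>j r. if i (prod_encode (k, prod_encode (r, Suc j))) = 1 then Suc j else r) j" for k j
  have ch: "enumerated u k s (ch k j) \<Longrightarrow> n \<le> j \<Longrightarrow> \<exists>s. enumerated u k s n" for k j n s
  proof (induction j arbitrary: n s)
    case 0
    then show ?case by (auto simp: ch_def)
  next
    case (Suc j)
    define x where "x = prod_encode (k, prod_encode (ch k j, Suc j))"
    have step: "ch k (Suc j) = (if i x = 1 then Suc j else ch k j)" by (simp add: ch_def x_def)
    have "(\<exists>s. enumerated u k s (ch k j)) \<and> (\<exists>s. enumerated u k s (Suc j))"
    proof (cases "i x = 1")
      case True
      then have "enumerated u k s (Suc j)" using Suc.prems step by simp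
      \<comment> \<open>If the winner were enumerated and the loser never, the winner would be
        strictly earlier, and \<open>i\<close> would have to prefer the loser.\<close>
      moreover have "\<not> snd_first u s x" using sep True by blast
      ultimately show ?thesis by (auto simp: snd_first_def earlier_def x_def)
    next
      case False
      then have "enumerated u k s (ch k j)" using Suc.prems step by simp
      moreover have "\<not> fst_first u s x" using sep False by blast
      ultimately show ?thesis by (auto simp: fst_first_def earlier_def x_def)
    qed
    then show ?case using Suc.IH Suc.prems(2) by (auto simp: le_Suc_eq)
  qed
  \<comment> \<open>Complexity above \<open>2 * k\<close> is demanded because the machine
    \<open>M\<close> below describes \<open>q k\<close> by a string of length
    \<open>k + 1\<close>.\<close>
  define q where "q k = ch (2 * k) (2 ^ Suc (2 * k))" for k
  have q: "\<not> enumerated u (2 * k) s (q k)" for k s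
    using not_all_enumerated[of "2 * k" u] ch[of "2 * k" s "2 ^ Suc (2 * k)"] by (auto simp: q_def)
  have "computable q"
    unfolding q_def ch_def by (intro computable_intros computable_comp[OF i])
  \<comment> \<open>An arithmetical form of the code of the unary string \<open>st k\<close>, from
    which its computability can be read off.\<close>
  define cd :: "nat \<Rightarrow> nat" where "cd k = 2 * rec_nat 0 (\<lambda>_ r. 2 * r + 2) k + 1" for k
  define st where "st k = replicate k True @ [False]" for k
  have cd: "nat_of_string (st k) = cd k" for k
  proof -
    have "nat_of_string (replicate k True) = rec_nat 0 (\<lambda>_ r. 2 * r + 2) k"
    proof (induction k)
      case (Suc k)
      have "nat_of_string (replicate (Suc k) True) = 2 * nat_of_string (replicate k True) + 2"
        unfolding replicate_Suc replicate_append_same[symmetric] by (simp add: nat_of_string_snoc)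
      then show ?case using Suc by simp
    qed simp
    then show ?thesis by (simp add: cd_def st_def nat_of_string_snoc)
  qed
  have st_simps: "st 0 = [False]" "st (Suc k) = True # st k" for k by (simp_all add: st_def)
  have st_prefix: "prefix (st k) (st l) \<Longrightarrow> k = l" for k l
  proof (induction k arbitrary: l)
    case 0
    then show ?case by (cases l) (simp_all add: st_simps)
  next
    case (Suc k)
    then show ?case by (cases l) (simp_all add: st_simps)
  qed
  define M where "M \<sigma> = (if \<sigma> \<in> range st then Some (string_of_nat (q (inv st \<sigma>))) else None)" for \<sigma>
  have inj: "inj st" using st_prefix by (simp add: inj_def)
  then have M: "M (st k) = Some (string_of_nat (q k))" for k by (simp add: M_def)
  have "partial_computable_string_fun M"
  proof -
    \<comment> \<open>Minimization inverts \<open>cd\<close> and diverges outside its range, which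
      gives \<open>M\<close> the right domain.\<close>
    have "partrec_in {} (\<lambda>n. Some (of_bool (cd (rproj n) \<noteq> lproj n)))"
      unfolding computable_def[symmetric] decidable_def[symmetric] cd_def
      by (intro computable_intros)
    from partrec_in.comp[OF \<open>computable q\<close>[unfolded computable_def] partrec_in.mu[OF this]]
    have "partrec_in {} (\<lambda>n. Option.bind (mu_op (\<lambda>k. Some (of_bool (cd k \<noteq> n)))) (\<lambda>k. Some (q k)))"
      by simp
    moreover have "Option.bind (mu_op (\<lambda>k. Some (of_bool (cd k \<noteq> n)))) (\<lambda>k. Some (q k)) =
        map_option nat_of_string (M (string_of_nat n))" for n
    proof (cases "\<exists>k. cd k = n")
      case True
      then obtain k where k: "cd k = n" by blast
      have "cd l \<noteq> n \<longleftrightarrow> l \<noteq> k" for l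
        unfolding cd[symmetric] k[symmetric] by (metis inj injD string_of_nat_inverse(1))
      then have "mu_op (\<lambda>k. Some (of_bool (cd k \<noteq> n))) = mu_op (\<lambda>l. Some (of_bool (l \<noteq> k)))"
        by simp
      also have "\<dots> = Some k" by (auto simp: mu_op_def intro: Least_equality)
      finally have "mu_op (\<lambda>k. Some (of_bool (cd k \<noteq> n))) = Some k" .
      moreover have "string_of_nat n = st k" using cd[of k] k by (metis string_of_nat_inverse(1))
      ultimately show ?thesis by (simp add: M)
    next
      case False
      then have "string_of_nat n \<notin> range st" using cd by (metis imageE string_of_nat_inverse(2))
      then show ?thesis using False by (simp add: M_def mu_op_def)
    qed
    ultimately show ?thesis unfolding partial_computable_string_fun_def by simp
  qed
  moreover have "\<sigma> = \<tau>" if "\<sigma> \<in> dom M" "\<tau> \<in> dom M" "prefix \<sigma> \<tau>" for \<sigma> \<tau>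
    using that st_prefix by (auto simp: M_def dom_def split: if_splits)
  ultimately have "prefix_free_machine M" by (auto simp: prefix_free_machine_def)
  then obtain c :: nat where c: "\<And>\<sigma>. machine_complexity U \<sigma> \<le> machine_complexity M \<sigma> + enat c"
    using U unfolding optimal_prefix_free_machine_def by blast
  \<comment> \<open>Then the length \<open>k + 1\<close> of \<open>st k\<close> plus
    \<open>c\<close> is exactly \<open>2 * k\<close>.\<close>
  define k where "k = Suc c"
  have "machine_complexity M (string_of_nat (q k)) \<le> enat (length (st k))"
    unfolding machine_complexity_def by (rule INF_lower) (simp add: M)
  then have "machine_complexity U (string_of_nat (q k)) \<le> enat (length (st k)) + enat c"
    using c[of "string_of_nat (q k)"] by (meson add_right_mono order_trans)
  also have "\<dots> < enat (Suc (2 * k))" by (simp add: st_def k_def)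
  finally obtain \<tau> where \<tau>: "U \<tau> = Some (string_of_nat (q k))" "length \<tau> < Suc (2 * k)"
    unfolding machine_complexity_def by (auto simp: INF_less_iff)
  obtain s where "run (\<lambda>_. 0) s u (nat_of_string \<tau>) = Suc (q k)"
    using u[of "nat_of_string \<tau>" "q k"] \<tau> by auto
  moreover have "nat_of_string \<tau> < 2 ^ Suc (2 * k)"
  proof -
    have "(2::nat) ^ Suc (length \<tau>) \<le> 2 ^ Suc (2 * k)" using \<tau>(2) by (intro power_increasing) auto
    then show ?thesis using nat_of_string_bounds(2)[of \<tau>] by linarith
  qed
  ultimately have "enumerated u (2 * k) s (q k)" unfolding enumerated_def by blast
  then show False using q by blast
qed

text \<open>Provides the enumeration \<open>from_nat\<close> of all oracle programs that the forcing
  runs through.\<close>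

instance prog :: countable by countable_datatype

subsection \<open>Weights and compactness\<close>

text \<open>Induction on a bound for the lengths: splitting by the first bit gives two prefix-free
  sets, each contributing half of its own sum.\<close>

lemma kraft_inequality:
  fixes S :: "bool list set"
  assumes "finite S" "\<And>\<sigma> \<tau>. \<sigma> \<in> S \<Longrightarrow> \<tau> \<in> S \<Longrightarrow> prefix \<sigma> \<tau> \<Longrightarrow> \<sigma> = \<tau>"
  shows "(\<Sum>\<sigma>\<in>S. (1/2::real) ^ length \<sigma>) \<le> 1"
proof -
  have "(\<Sum>\<sigma>\<in>S. (1/2::real) ^ length \<sigma>) \<le> 1"
    if "finite S" "\<And>\<sigma> \<tau>. \<sigma> \<in> S \<Longrightarrow> \<tau> \<in> S \<Longrightarrow> prefix \<sigma> \<tau> \<Longrightarrow> \<sigma> = \<tau>" "\<And>\<sigma>. \<sigma> \<in> S \<Longrightarrow> length \<sigma> < L"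
    for L and S :: "bool list set"
    using that
  proof (induction L arbitrary: S)
    case 0
    then have "S = {}" by auto
    then show ?case by simp
  next
    case (Suc L)
    show ?case
    proof (cases "[] \<in> S")
      case True
      then have "S = {[]}" using Suc.prems(2)[of "[]"] by auto
      then show ?thesis by simp
    next
      case False
      define R where "R b = {\<sigma>. b # \<sigma> \<in> S}" for b
      have S: "S = Cons True ` R True \<union> Cons False ` R False"
      proof (intro equalityI subsetI)
        fix \<sigma> assume "\<sigma> \<in> S"
        then show "\<sigma> \<in> Cons True ` R True \<union> Cons False ` R False"
          using False by (cases \<sigma>; cases "hd \<sigma>") (auto simp: R_def)
      qed (auto simp: R_def)
      have fin: "finite (R b)" for b
      proof (rule finite_imageD[of "Cons b"])
        show "finite (Cons b ` R b)"
          by (rule finite_subset[OF _ Suc.prems(1)]) (auto simp: R_def)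
      qed simp
      have le: "(\<Sum>\<sigma>\<in>R b. (1/2::real) ^ length \<sigma>) \<le> 1" for b
      proof (rule Suc.IH)
        show "\<sigma> = \<tau>" if "\<sigma> \<in> R b" "\<tau> \<in> R b" "prefix \<sigma> \<tau>" for \<sigma> \<tau>
          using Suc.prems(2)[of "b # \<sigma>" "b # \<tau>"] that by (simp add: R_def)
        show "length \<sigma> < L" if "\<sigma> \<in> R b" for \<sigma>
          using Suc.prems(3)[of "b # \<sigma>"] that by (simp add: R_def)
      qed (rule fin)
      have img: "(\<Sum>\<sigma>\<in>Cons b ` R b. (1/2::real) ^ length \<sigma>) = (\<Sum>\<sigma>\<in>R b. (1/2) ^ length \<sigma>) / 2" for b
        by (simp add: sum.reindex sum_divide_distrib)
      have "(\<Sum>\<sigma>\<in>S. (1/2::real) ^ length \<sigma>) =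
          (\<Sum>\<sigma>\<in>Cons True ` R True. (1/2) ^ length \<sigma>) + (\<Sum>\<sigma>\<in>Cons False ` R False. (1/2) ^ length \<sigma>)"
        by (subst S, rule sum.union_disjoint) (auto simp: fin)
      then show ?thesis using le[of True] le[of False] by (simp add: img)
    qed
  qed
  moreover have "\<exists>L. \<forall>\<sigma>\<in>S. length \<sigma> < L"
    using assms(1) finite_nat_set_iff_bounded[of "length ` S"] by auto
  ultimately show ?thesis using assms by blast
qed

text \<open>Every number is read as an infinite sequence, with the head on the left of nested
  pairs.\<close>

definition nth_code :: "nat \<Rightarrow> nat \<Rightarrow> nat" where
  "nth_code z n = lproj (rec_nat z (\<lambda>_ r. rproj r) n)"

text \<open>The code of \<open>k\<close> entries \<open>M\<close> followed by 0; as pairing is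
  monotone, it bounds suitable codes of all sequences of \<open>k\<close> entries up to
  \<open>M\<close>.\<close>

definition code_bound :: "nat \<Rightarrow> nat \<Rightarrow> nat" where
  "code_bound M k = rec_nat 0 (\<lambda>_ r. prod_encode (M, r)) k"

lemma computable_nth_code [computable_intros]:
  "computable f \<Longrightarrow> computable g \<Longrightarrow> computable (\<lambda>x. nth_code (f x) (g x))"
  unfolding nth_code_def by (intro computable_intros)

lemma computable_code_bound [computable_intros]:
  assumes "computable f" "computable g" shows "computable (\<lambda>x. code_bound (f x) (g x))"
  unfolding code_bound_def by (intro computable_intros assms computable_comp[OF assms(1)])

lemma prod_encode_mono: "a \<le> a' \<Longrightarrow> b \<le> b' \<Longrightarrow> prod_encode (a, b) \<le> prod_encode (a', b')"
proof -
  have "mono triangle" by (simp add: mono_iff_le_Suc)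
  then show "a \<le> a' \<Longrightarrow> b \<le> b' \<Longrightarrow> ?thesis"
    unfolding prod_encode_def by (auto intro!: add_mono dest: monoD)
qed

lemma nth_code_pair:
  "nth_code (prod_encode (a, z)) 0 = a" "nth_code (prod_encode (a, z)) (Suc n) = nth_code z n"
proof -
  have "rec_nat y (\<lambda>_ r. rproj r) (Suc n) = rec_nat (rproj y) (\<lambda>_ r. rproj r) n" for y n
    by (induction n) auto
  from this[of "prod_encode (a, z)" n]
  show "nth_code (prod_encode (a, z)) (Suc n) = nth_code z n" by (simp add: nth_code_def)
qed (simp add: nth_code_def)

text \<open>Turns quantification over bounded functions on an initial segment into bounded
  quantification over numbers.\<close>

lemma ex_nth_code:
  assumes "\<And>n. n < k \<Longrightarrow> v n \<le> M"
  shows "\<exists>z<Suc (code_bound M k). \<forall>n<k. nth_code z n = v n"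
  using assms
proof (induction k arbitrary: v)
  case (Suc k)
  obtain z where z: "z \<le> code_bound M k" "\<forall>n<k. nth_code z n = v (Suc n)"
    using Suc.IH[of "\<lambda>n. v (Suc n)"] Suc.prems by (auto simp: less_Suc_eq_le)
  have "prod_encode (v 0, z) \<le> code_bound M (Suc k)"
    using z(1) Suc.prems[of 0] by (auto simp: code_bound_def intro: prod_encode_mono)
  moreover have "\<forall>n<Suc k. nth_code (prod_encode (v 0, z)) n = v n"
    using z(2) by (auto simp: less_Suc_eq_0_disj nth_code_pair)
  ultimately show ?case by (auto simp: less_Suc_eq_le)
qed auto

text \<open>Compactness of the product of the finite sets \<open>{..g n}\<close>: the pigeonhole
  principle thins out the indices to nested infinite sets \<open>S u\<close> on which the functions
  agree below \<open>u\<close>.\<close>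

lemma pointwise_subsequence:
  fixes F :: "nat \<Rightarrow> nat \<Rightarrow> nat"
  assumes bound: "\<And>k n. F k n \<le> g n"
  shows "\<exists>G. \<forall>M. \<exists>k\<ge>M. \<forall>n<M. F k n = G n"
proof -
  have "\<exists>S. \<forall>u. (infinite (S u) \<and> (\<forall>k\<in>S u. \<forall>j\<in>S u. \<forall>n<u. F k n = F j n)) \<and> S (Suc u) \<subseteq> S u"
  proof (rule dependent_nat_choice)
    show "\<exists>S. infinite S \<and> (\<forall>k\<in>S. \<forall>j\<in>S. \<forall>n<0. F k n = F j n)"
      by (intro exI[of _ UNIV]) auto
    fix S u assume S: "infinite S \<and> (\<forall>k\<in>S. \<forall>j\<in>S. \<forall>n<u. F k n = F j n)"
    have "finite ((\<lambda>k. F k u) ` S)"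
      by (rule finite_subset[of _ "{..g u}"]) (auto simp: bound)
    then obtain k0 where k0: "infinite {k \<in> S. F k u = F k0 u}"
      using pigeonhole_infinite[of S "\<lambda>k. F k u"] S by auto
    show "\<exists>S'. (infinite S' \<and> (\<forall>k\<in>S'. \<forall>j\<in>S'. \<forall>n<Suc u. F k n = F j n)) \<and> S' \<subseteq> S"
      using k0 S by (intro exI[of _ "{k \<in> S. F k u = F k0 u}"]) (auto simp: less_Suc_eq)
  qed
  then obtain S where S: "\<And>u. (infinite (S u) \<and> (\<forall>k\<in>S u. \<forall>j\<in>S u. \<forall>n<u. F k n = F j n)) \<and>
      S (Suc u) \<subseteq> S u" by (elim exE) (rule that, erule spec)
  have inf: "infinite (S u)" and dec: "S (Suc u) \<subseteq> S u" for u using S[of u] by auto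
  have agree: "F k n = F j n" if "k \<in> S u" "j \<in> S u" "n < u" for u k j n using S[of u] that by blast
  define G where "G n = F (SOME k. k \<in> S (Suc n)) n" for n
  have G: "F k n = G n" if "k \<in> S u" "n < u" for k n u
  proof -
    have "S u \<subseteq> S (Suc n)" by (rule lift_Suc_antimono_le[of S, OF dec]) (use that(2) in simp)
    moreover have "(SOME k. k \<in> S (Suc n)) \<in> S (Suc n)"
      using infinite_imp_nonempty[OF inf] by (simp add: some_in_eq)
    ultimately show ?thesis unfolding G_def using agree that(1) by blast
  qed
  have "\<exists>k\<ge>M. \<forall>n<M. F k n = G n" for M
    using inf[of M] G[of _ M] unfolding infinite_nat_iff_unbounded_le by blast
  then show ?thesis by blast
qed

text \<open>A bound on an infinite sum is expressed as a bound on these partial sums for all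
  \<open>N\<close>.\<close>

definition weight :: "(nat \<Rightarrow> nat) \<Rightarrow> nat \<Rightarrow> nat \<Rightarrow> real" where
  "weight v l N = (\<Sum>n=l..<N. (1/2) ^ v n)"

lemma weight_nonneg [simp]: "0 \<le> weight v l N"
  by (simp add: weight_def sum_nonneg)

lemma weight_cong: "(\<And>n. l \<le> n \<Longrightarrow> n < N \<Longrightarrow> v n = w n) \<Longrightarrow> weight v l N = weight w l N"
  by (simp add: weight_def)

lemma weight_append: "l \<le> m \<Longrightarrow> m \<le> N \<Longrightarrow> weight v l N = weight v l m + weight v m N"
  by (simp add: weight_def sum.atLeastLessThan_concat)

lemma weight_subset: "l \<le> l' \<Longrightarrow> N' \<le> N \<Longrightarrow> weight v l' N' \<le> weight v l N"
  unfolding weight_def by (rule sum_mono2) auto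

lemma weight_min: "weight (\<lambda>n. min (v n) (w n)) l N \<le> weight v l N + weight w l N"
  unfolding weight_def sum.distrib[symmetric] by (rule sum_mono) (auto simp: min_def)

text \<open>Once a partial sum is within \<open>\<eta>\<close> of the supremum, at most
  \<open>\<eta>\<close> remains.\<close>

lemma weight_tail:
  assumes r: "\<And>N. weight g l N \<le> r" and "0 < \<eta>"
  shows "\<exists>l'>l. \<forall>N. weight g l' N \<le> \<eta>"
proof -
  define s where "s = (SUP N. weight g l N)"
  have bdd: "bdd_above (range (weight g l))" using r by (intro bdd_aboveI[of _ r]) auto
  have "s - \<eta> < s" using assms(2) by simp
  then obtain m where m: "s - \<eta> < weight g l m"
    unfolding s_def using less_cSUP_iff[OF _ bdd] by blast
  define l' where "l' = max (Suc l) m"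
  have "weight g l' N \<le> \<eta>" for N
  proof (cases "l' \<le> N")
    case True
    have "weight g l N \<le> s" unfolding s_def by (rule cSUP_upper[OF _ bdd]) simp
    moreover have "weight g l m \<le> weight g l l'" by (rule weight_subset) (auto simp: l'_def)
    moreover have "weight g l N = weight g l l' + weight g l' N"
      using True by (intro weight_append) (auto simp: l'_def)
    ultimately show ?thesis using m by linarith
  qed (use assms(2) in \<open>simp add: weight_def\<close>)
  then show ?thesis by (intro exI[of _ l']) (auto simp: l'_def)
qed

subsection \<open>Large answers\<close>

text \<open>
  The restriction \<open>v n \<le> n\<close> leaves only finitely many functions to check below \<open>N\<close>, which makes
  \<open>large\<close> decidable; it costs nothing since the \<open>g\<close> of a condition obeys the same bound.
\<close>

definition large :: "(nat \<Rightarrow> nat) \<Rightarrow> nat \<Rightarrow> nat \<Rightarrow> prog \<Rightarrow> nat \<Rightarrow> nat \<Rightarrow> nat \<Rightarrow> bool" where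
  "large \<sigma> l a c i x N \<longleftrightarrow> l < N \<and>
    (\<forall>v. (\<forall>n. v n \<le> n) \<and> weight v l N \<le> (1/2) ^ a \<longrightarrow>
      (\<exists>w. (\<forall>n<l. w n = \<sigma> n) \<and> (\<forall>n. l \<le> n \<and> n < N \<longrightarrow> w n \<le> v n) \<and>
        weight w l N \<le> 8 * (1/2) ^ a \<and> run w N c x = Suc i))"

text \<open>Multiplication by \<open>2 ^ (a + N)\<close> clears the denominators, because
  \<open>v n \<le> n < N\<close>. This makes weight bounds decidable by arithmetic on natural
  numbers.\<close>

lemma weight_le_iff_nat:
  assumes "\<And>n. n < N \<Longrightarrow> v n \<le> n"
  shows "weight v l N \<le> real b * (1/2) ^ a \<longleftrightarrow>
    (\<Sum>n<N. if n < l then 0 else 2 ^ (a + N - v n)) \<le> b * 2 ^ N"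
proof -
  have "(\<Sum>n<N. if n < l then 0 else 2 ^ (a + N - v n)) = (\<Sum>n=l..<N. (2::nat) ^ (a + N - v n))"
    by (rule sum.mono_neutral_cong_right) auto
  then have "real (\<Sum>n<N. if n < l then 0 else 2 ^ (a + N - v n)) = (\<Sum>n=l..<N. 2 ^ (a + N - v n))"
    by simp
  also have "\<dots> = (\<Sum>n=l..<N. 2 ^ (a + N) * (1/2) ^ v n)"
  proof (rule sum.cong[OF refl])
    fix n assume "n \<in> {l..<N}"
    then have "v n \<le> a + N" using assms[of n] by auto
    then show "(2::real) ^ (a + N - v n) = 2 ^ (a + N) * (1/2) ^ v n"
      by (simp add: power_diff power_one_over)
  qed
  also have "\<dots> = 2 ^ (a + N) * weight v l N" by (simp add: weight_def sum_distrib_left)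
  finally have eq: "real (\<Sum>n<N. if n < l then 0 else 2 ^ (a + N - v n)) = 2 ^ (a + N) * weight v l N" .
  have "(\<Sum>n<N. if n < l then 0 else 2 ^ (a + N - v n)) \<le> b * 2 ^ N \<longleftrightarrow>
      2 ^ (a + N) * weight v l N \<le> real (b * 2 ^ N)"
    unfolding eq[symmetric] by (rule of_nat_le_iff[symmetric])
  also have "\<dots> \<longleftrightarrow> weight v l N \<le> real b * (1/2) ^ a"
    by (simp add: power_add field_simps)
  finally show ?thesis by simp
qed

text \<open>Both \<open>v\<close> and \<open>w\<close> are bounded by the identity below
  \<open>N\<close>, so they range over finitely many codes. The function \<open>\<sigma>\<close> may
  be noncomputable: its finitely many values below \<open>l\<close> are stored in one constant
  \<open>t\<close>.\<close>

lemma decidable_large: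
  assumes \<sigma>: "\<And>n. \<sigma> n \<le> n" and f: "computable f" and g: "computable g"
  shows "decidable (\<lambda>x. large \<sigma> l a c i (f x) (g x))"
proof -
  let ?W = "\<lambda>v N. \<Sum>n<N. if n < l then 0 else (2::nat) ^ (a + N - v n)"
  obtain t where t: "\<And>n. n < l \<Longrightarrow> nth_code t n = \<sigma> n"
    using ex_nth_code[of l \<sigma> l] \<sigma> by (meson le_trans less_imp_le)
  have "large \<sigma> l a c i x N \<longleftrightarrow> l < N \<and> (\<forall>z<Suc (code_bound N N).
      (\<forall>n<N. nth_code z n \<le> n) \<and> ?W (nth_code z) N \<le> 1 * 2 ^ N \<longrightarrow>
      (\<exists>y<Suc (code_bound N N). (\<forall>n<N. (n < l \<longrightarrow> nth_code y n = nth_code t n) \<and>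
          (l \<le> n \<longrightarrow> nth_code y n \<le> nth_code z n)) \<and>
        ?W (nth_code y) N \<le> 8 * 2 ^ N \<and> run (nth_code y) N c x = Suc i))"
    (is "_ \<longleftrightarrow> _ \<and> ?R") for x N
  proof -
    have "?R \<longleftrightarrow> (\<forall>v. (\<forall>n. v n \<le> n) \<and> weight v l N \<le> (1/2) ^ a \<longrightarrow>
      (\<exists>w. (\<forall>n<l. w n = \<sigma> n) \<and> (\<forall>n. l \<le> n \<and> n < N \<longrightarrow> w n \<le> v n) \<and>
        weight w l N \<le> 8 * (1/2) ^ a \<and> run w N c x = Suc i))" (is "_ \<longleftrightarrow> ?S") if "l < N"
    proof (intro iffI allI impI)
      fix v assume R: ?R and v: "(\<forall>n. v n \<le> n) \<and> weight v l N \<le> (1/2) ^ a"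
      obtain z where z: "z < Suc (code_bound N N)" "\<And>n. n < N \<Longrightarrow> nth_code z n = v n"
        using ex_nth_code[of N v N] v by (meson le_trans less_imp_le)
      have zn: "\<forall>n<N. nth_code z n \<le> n" using z v by auto
      have "weight (nth_code z) l N \<le> real 1 * (1/2) ^ a"
        using v weight_cong[of l N "nth_code z" v] z(2) by simp
      then have "?W (nth_code z) N \<le> 1 * 2 ^ N" using weight_le_iff_nat[of N "nth_code z" l 1 a] zn by blast
      with R z(1) zn obtain y where y: "\<And>n. n < N \<Longrightarrow> (n < l \<longrightarrow> nth_code y n = nth_code t n) \<and>
          (l \<le> n \<longrightarrow> nth_code y n \<le> nth_code z n)"
        "?W (nth_code y) N \<le> 8 * 2 ^ N" "run (nth_code y) N c x = Suc i" by blast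
      have yn: "nth_code y n \<le> n" if "n < N" for n
        using y(1)[OF that] zn t[of n] \<sigma>[of n] that by (cases "n < l") (auto intro: le_trans)
      have "weight (nth_code y) l N \<le> 8 * (1/2) ^ a"
        using y(2) weight_le_iff_nat[of N "nth_code y" l 8 a] yn by simp
      then show "\<exists>w. (\<forall>n<l. w n = \<sigma> n) \<and> (\<forall>n. l \<le> n \<and> n < N \<longrightarrow> w n \<le> v n) \<and>
        weight w l N \<le> 8 * (1/2) ^ a \<and> run w N c x = Suc i"
        using y t z(2) \<open>l < N\<close> by (intro exI[of _ "nth_code y"]) auto
    next
      fix z assume S: ?S and z: "(\<forall>n<N. nth_code z n \<le> n) \<and> ?W (nth_code z) N \<le> 1 * 2 ^ N"
      \<comment> \<open>From \<open>N\<close> on the entries of \<open>z\<close> are uncontrolled;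
        the default 0 ensures \<open>v n \<le> n\<close>.\<close>
      define v where "v n = (if n < N then nth_code z n else 0)" for n
      have "weight (nth_code z) l N \<le> real 1 * (1/2) ^ a"
        using z weight_le_iff_nat[of N "nth_code z" l 1 a] by blast
      then have "weight v l N \<le> (1/2) ^ a" using weight_cong[of l N v "nth_code z"] by (simp add: v_def)
      moreover have vn: "\<forall>n. v n \<le> n" using z by (simp add: v_def)
      ultimately obtain w where w: "\<And>n. n < l \<Longrightarrow> w n = \<sigma> n" "\<And>n. l \<le> n \<Longrightarrow> n < N \<Longrightarrow> w n \<le> v n"
        "weight w l N \<le> 8 * (1/2) ^ a" "run w N c x = Suc i"
        using S[THEN spec[of _ v]] by auto
      have wn: "w n \<le> n" if "n < N" for n
        using w(1)[of n] w(2)[of n] \<sigma>[of n] vn that by (cases "n < l") (auto intro: le_trans)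
      obtain y where y: "y < Suc (code_bound N N)" "\<And>n. n < N \<Longrightarrow> nth_code y n = w n"
        using ex_nth_code[of N w N] wn by (meson le_trans less_imp_le)
      have "weight (nth_code y) l N \<le> real 8 * (1/2) ^ a"
        using w(3) weight_cong[of l N "nth_code y" w] y(2) by simp
      then have "?W (nth_code y) N \<le> 8 * 2 ^ N"
        using weight_le_iff_nat[of N "nth_code y" l 8 a] wn y(2) by auto
      moreover have "run (nth_code y) N c x = Suc i" using run_cong[of N "nth_code y" w] y(2) w(4) by simp
      moreover have "(n < l \<longrightarrow> nth_code y n = nth_code t n) \<and> (l \<le> n \<longrightarrow> nth_code y n \<le> nth_code z n)"
        if "n < N" for n
        using y(2) w(1,2)[of n] t that by (auto simp: v_def)
      ultimately show "\<exists>y<Suc (code_bound N N). (\<forall>n<N. (n < l \<longrightarrow> nth_code y n = nth_code t n) \<and>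
          (l \<le> n \<longrightarrow> nth_code y n \<le> nth_code z n)) \<and>
        ?W (nth_code y) N \<le> 8 * 2 ^ N \<and> run (nth_code y) N c x = Suc i" using y(1) by blast
    qed
    then show ?thesis unfolding large_def by blast
  qed
  then show ?thesis
    by (simp only:) (intro computable_intros computable_run[where D=nth_code] f g f[THEN computable_comp] g[THEN computable_comp])
qed

text \<open>
  The bounds that defeat \<open>i\<close> at the stages \<open>N\<close> have a limit point once they are capped by \<open>g\<close>.
\<close>

lemma not_large_restrict:
  assumes not_large: "\<And>N. \<not> large \<sigma> l a c i x N"
    and \<sigma>: "\<And>n. n < l \<Longrightarrow> g n = \<sigma> n" and g: "\<And>N. weight g l N \<le> r"
  shows "\<exists>g'. (\<forall>n<l. g' n = \<sigma> n) \<and> (\<forall>n. g' n \<le> g n) \<and> (\<forall>N. weight g' l N \<le> r + (1/2) ^ a) \<and>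
    (\<forall>h s. (\<forall>n<l. h n = \<sigma> n) \<and> (\<forall>n\<ge>l. h n \<le> g' n) \<and> (\<forall>N. weight h l N \<le> 4 * (1/2) ^ a)
      \<longrightarrow> run h s c x \<noteq> Suc i)"
proof -
  have "\<forall>N. \<exists>v. l < N \<longrightarrow> (weight v l N \<le> (1/2) ^ a \<and>
      (\<forall>w. (\<forall>n<l. w n = \<sigma> n) \<and> (\<forall>n. l \<le> n \<and> n < N \<longrightarrow> w n \<le> v n) \<and>
        weight w l N \<le> 8 * (1/2) ^ a \<longrightarrow> run w N c x \<noteq> Suc i))"
  proof
    fix N
    show "\<exists>v. l < N \<longrightarrow> (weight v l N \<le> (1/2) ^ a \<and>
      (\<forall>w. (\<forall>n<l. w n = \<sigma> n) \<and> (\<forall>n. l \<le> n \<and> n < N \<longrightarrow> w n \<le> v n) \<and>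
        weight w l N \<le> 8 * (1/2) ^ a \<longrightarrow> run w N c x \<noteq> Suc i))"
      using not_large[of N] unfolding large_def by blast
  qed
  then obtain v where "\<forall>N. l < N \<longrightarrow> (weight (v N) l N \<le> (1/2) ^ a \<and>
      (\<forall>w. (\<forall>n<l. w n = \<sigma> n) \<and> (\<forall>n. l \<le> n \<and> n < N \<longrightarrow> w n \<le> v N n) \<and>
        weight w l N \<le> 8 * (1/2) ^ a \<longrightarrow> run w N c x \<noteq> Suc i))" by (rule choice[THEN exE])
  then have v: "\<And>N. l < N \<Longrightarrow> weight (v N) l N \<le> (1/2) ^ a"
    and v_run: "\<And>N w. l < N \<Longrightarrow> (\<forall>n<l. w n = \<sigma> n) \<Longrightarrow> (\<forall>n. l \<le> n \<and> n < N \<longrightarrow> w n \<le> v N n) \<Longrightarrow>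
        weight w l N \<le> 8 * (1/2) ^ a \<Longrightarrow> run w N c x \<noteq> Suc i" by simp_all
  \<comment> \<open>Capping by \<open>g\<close> makes the family pointwise bounded, so it has a
    limit \<open>G\<close>, which then lies below \<open>g\<close>.\<close>
  define F where "F N n = (if l \<le> n \<and> n < N then min (v N n) (g n) else g n)" for N n
  have "F N n \<le> g n" for N n by (simp add: F_def)
  then obtain G where G: "\<And>M. \<exists>N\<ge>M. \<forall>n<M. F N n = G n" using pointwise_subsequence[of F g] by blast
  have "G n = \<sigma> n" if "n < l" for n
    using G[of l] that \<sigma> by (auto simp: F_def)
  moreover have "G n \<le> g n" for n
    using G[of "Suc n"] \<open>\<And>N n. F N n \<le> g n\<close> by (metis lessI)
  moreover have "weight G l M \<le> r + (1/2) ^ a" for M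
  proof -
    obtain N where N: "max M (Suc l) \<le> N" "\<And>n. n < max M (Suc l) \<Longrightarrow> F N n = G n"
      using G[of "max M (Suc l)"] by blast
    have "weight G l M = weight (\<lambda>n. min (v N n) (g n)) l M"
    proof (rule weight_cong)
      fix n assume "l \<le> n" "n < M"
      then show "G n = min (v N n) (g n)" using N(1) N(2)[of n] by (simp add: F_def)
    qed
    also have "\<dots> \<le> weight (v N) l M + weight g l M" by (rule weight_min)
    also have "weight (v N) l M \<le> weight (v N) l N" using N(1) by (intro weight_subset) auto
    also have "\<dots> \<le> (1/2) ^ a" using v N(1) by simp
    finally show ?thesis using g[of M] by simp
  qed
  moreover have "run h s c x \<noteq> Suc i"
    if h: "\<forall>n<l. h n = \<sigma> n" "\<forall>n\<ge>l. h n \<le> G n" "\<forall>N. weight h l N \<le> 4 * (1/2) ^ a" for h s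
  proof
    assume run: "run h s c x = Suc i"
    define M where "M = max s (Suc l)"
    obtain N where N: "M \<le> N" "\<And>n. n < M \<Longrightarrow> F N n = G n" using G[of M] by blast
    have lN: "l < N" "l \<le> M" "s \<le> N" using N(1) by (auto simp: M_def)
    \<comment> \<open>Below \<open>M\<close> the bound \<open>G\<close> agrees with
      \<open>F N\<close>, so \<open>h\<close> respects \<open>v N\<close> there; further on it may
      not, and is replaced by \<open>v N\<close>. The computation does not notice, since it queries
      only below \<open>s \<le> M\<close>.\<close>
    define w where "w n = (if n < M then h n else v N n)" for n
    have "run w s c x = run h s c x" by (rule run_cong) (auto simp: w_def M_def)
    then have "run w s c x = Suc i" using run by simp
    then have "run w N c x = Suc i" using lN(3) by (rule run_mono_Suc)
    moreover have "\<forall>n<l. w n = \<sigma> n" using h(1) lN by (simp add: w_def)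
    moreover have "\<forall>n. l \<le> n \<and> n < N \<longrightarrow> w n \<le> v N n"
    proof (intro allI impI)
      fix n assume n: "l \<le> n \<and> n < N"
      then have "h n \<le> F N n" if "n < M" using N(2)[OF that] h(2) by simp
      then show "w n \<le> v N n" using n by (auto simp: w_def F_def)
    qed
    \<comment> \<open>Four units come from \<open>h\<close> and one from \<open>v N\<close>, within
      the eight allowed.\<close>
    moreover have "weight w l N \<le> 8 * (1/2) ^ a"
    proof -
      have "weight w l N = weight w l M + weight w M N" using lN N(1) by (intro weight_append)
      also have "weight w l M = weight h l M" by (rule weight_cong) (simp add: w_def)
      also have "weight w M N = weight (v N) M N" by (rule weight_cong) (simp add: w_def)
      also have "\<dots> \<le> weight (v N) l N" using lN by (intro weight_subset) auto
      also have "\<dots> \<le> (1/2) ^ a" using v lN(1) by blast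
      finally have "weight w l N \<le> weight h l M + (1/2) ^ a" by simp
      moreover have "weight h l M \<le> 4 * (1/2) ^ a" using h(3) by blast
      moreover have "0 \<le> (1/2::real) ^ a" by simp
      ultimately show ?thesis by linarith
    qed
    ultimately show False using v_run[OF lN(1)] by blast
  qed
  ultimately show ?thesis by (intro exI[of _ G]) blast
qed

subsection \<open>Forcing\<close>

text \<open>
  The inequality between \<open>r\<close> and \<open>e\<close> is strict, so that every condition leaves weight to spend.
\<close>

definition condition :: "(nat \<Rightarrow> nat) \<Rightarrow> nat \<Rightarrow> real \<Rightarrow> bool" where
  "condition g l e \<longleftrightarrow> (\<forall>n. g n \<le> n) \<and> (\<exists>r<e. \<forall>N. weight g l N \<le> r)"

definition admits :: "(nat \<Rightarrow> nat) \<Rightarrow> nat \<Rightarrow> real \<Rightarrow> (nat \<Rightarrow> nat) \<Rightarrow> bool" where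
  "admits g l e h \<longleftrightarrow> (\<forall>n<l. h n = g n) \<and> (\<forall>n\<ge>l. h n \<le> g n) \<and> (\<forall>N. weight h l N \<le> e)"

text \<open>The weight of the newly fixed values is paid out of the budget \<open>e\<close>. The
  strict \<open>l < l'\<close> makes a sequence of refinements settle every value.\<close>

definition refines :: "(nat \<Rightarrow> nat) \<Rightarrow> nat \<Rightarrow> real \<Rightarrow> (nat \<Rightarrow> nat) \<Rightarrow> nat \<Rightarrow> real \<Rightarrow> bool" where
  "refines g' l' e' g l e \<longleftrightarrow> l < l' \<and> (\<forall>n<l. g' n = g n) \<and> (\<forall>n. g' n \<le> g n) \<and>
    weight g' l l' + e' \<le> e"

lemma condition_admits_self: "condition g l e \<Longrightarrow> admits g l e g"
  unfolding condition_def admits_def by (meson less_imp_le order_trans order_refl)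

lemma refines_admits:
  assumes r: "refines g' l' e' g l e" and h: "admits g' l' e' h" and e: "0 \<le> e'"
  shows "admits g l e h"
  unfolding admits_def
proof (intro conjI allI impI)
  have ll: "l \<le> l'" using r by (simp add: refines_def)
  show "h n = g n" if "n < l" for n using r h that by (simp add: refines_def admits_def)
  show "h n \<le> g n" if "l \<le> n" for n
  proof -
    have "h n \<le> g' n" using h by (cases "n < l'") (auto simp: admits_def)
    also have "\<dots> \<le> g n" using r by (simp add: refines_def)
    finally show ?thesis .
  qed
  have w: "weight h l l' = weight g' l l'" using h by (intro weight_cong) (simp add: admits_def)
  show "weight h l N \<le> e" for N
  proof (cases "l' \<le> N")
    case True
    then have "weight h l N = weight g' l l' + weight h l' N" using weight_append[OF ll True] w by simp
    moreover have "weight h l' N \<le> e'" using h by (simp add: admits_def)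
    ultimately show ?thesis using r by (simp add: refines_def)
  next
    case False
    then have "weight h l N \<le> weight h l l'" by (intro weight_subset) auto
    then show ?thesis using r w e by (simp add: refines_def)
  qed
qed

lemma force_no_separator:
  assumes U: "optimal_prefix_free_machine U"
    and u: "\<And>n v. map_option nat_of_string (U (string_of_nat n)) = Some v \<Longrightarrow>
      \<exists>s. run (\<lambda>_. 0) s u n = Suc v"
    and cond: "condition g l e"
  shows "\<exists>g' l' e'. condition g' l' e' \<and> refines g' l' e' g l e \<and>
    (\<forall>h X. admits g' l' e' h \<and> X \<in> separators u \<longrightarrow> \<not> (\<forall>n. \<exists>s. run h s c n = Suc (of_bool (X n))))"
proof -
  from cond obtain r where gn: "\<And>n. g n \<le> n" and r: "r < e" "\<And>N. weight g l N \<le> r"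
    by (auto simp: condition_def)
  \<comment> \<open>With unit \<open>\<delta> = (1/2) ^ a\<close>, the first case below needs 4
    units beyond \<open>r\<close>, the second 8 for the witness and 2 for the new budget; 16 suffice
    for both.\<close>
  obtain a where "(1/2::real) ^ a < (e - r) / 16"
    using real_arch_pow_inv[of "(e - r) / 16" "1/2"] r(1) by auto
  then obtain \<delta> where \<delta>: "\<delta> = (1/2::real) ^ a" "16 * \<delta> \<le> e - r" "0 < \<delta>" by simp
  \<comment> \<open>Fixing \<open>g\<close> up to \<open>m\<close> leaves a tail of at most one
    unit, so that \<open>g\<close> itself is one of the bounds \<open>v\<close> tested by
    \<open>large\<close>.\<close>
  obtain m where m: "l < m" "\<And>N. weight g m N \<le> \<delta>" using weight_tail[OF r(2) \<delta>(3)] by blast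
  show ?thesis
  proof (cases "\<exists>x. \<forall>N. \<not> large g m a c 0 x N \<and> \<not> large g m a c 1 x N")
    case True
    then obtain x where x: "\<And>N. \<not> large g m a c 0 x N" "\<And>N. \<not> large g m a c 1 x N" by blast
    obtain g1 where g1: "\<forall>n<m. g1 n = g n" "\<forall>n. g1 n \<le> g n" "\<forall>N. weight g1 m N \<le> \<delta> + \<delta>"
      "\<And>h s. (\<forall>n<m. h n = g n) \<Longrightarrow> (\<forall>n\<ge>m. h n \<le> g1 n) \<Longrightarrow> (\<forall>N. weight h m N \<le> 4 * \<delta>)
        \<Longrightarrow> run h s c x \<noteq> Suc 0"
      using not_large_restrict[of g m a c 0 x g \<delta>, OF x(1) refl m(2)] unfolding \<delta>(1)[symmetric]
      by auto
    \<comment> \<open>Excluding both answers raises the tail from one unit to three, still strictly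
      below the budget of four for which the exclusions are guaranteed.\<close>
    obtain g2 where g2: "\<forall>n<m. g2 n = g n" "\<forall>n. g2 n \<le> g1 n" "\<forall>N. weight g2 m N \<le> (\<delta> + \<delta>) + \<delta>"
      "\<And>h s. (\<forall>n<m. h n = g n) \<Longrightarrow> (\<forall>n\<ge>m. h n \<le> g2 n) \<Longrightarrow> (\<forall>N. weight h m N \<le> 4 * \<delta>)
        \<Longrightarrow> run h s c x \<noteq> Suc 1"
      using not_large_restrict[of g m a c 1 x g1 "\<delta> + \<delta>", OF x(2) g1(1)[rule_format] g1(3)[rule_format]]
      unfolding \<delta>(1)[symmetric] by auto
    have g2g: "g2 n \<le> g n" for n using g1(2) g2(2) by (meson order_trans)
    have "condition g2 m (4 * \<delta>)"
      unfolding condition_def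
      using g2(3) \<delta>(3) g2g gn by (intro conjI exI[of _ "\<delta> + \<delta> + \<delta>"]) (auto intro: order_trans)
    moreover have "refines g2 m (4 * \<delta>) g l e"
    proof -
      have "weight g2 l m = weight g l m" using g2(1) by (intro weight_cong) simp
      then show ?thesis unfolding refines_def using m(1) g2(1) g2g r(2)[of m] \<delta>(2,3) by auto
    qed
    moreover have "\<not> (\<forall>n. \<exists>s. run h s c n = Suc (of_bool (X n)))" if h: "admits g2 m (4 * \<delta>) h" for h X
    proof
      assume "\<forall>n. \<exists>s. run h s c n = Suc (of_bool (X n))"
      then obtain s where s: "run h s c x = Suc (of_bool (X x))" by blast
      have h': "\<forall>n<m. h n = g n" "\<forall>n\<ge>m. h n \<le> g2 n" "\<forall>n\<ge>m. h n \<le> g1 n" "\<forall>N. weight h m N \<le> 4 * \<delta>"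
        using h g2(1,2) by (auto simp: admits_def intro: order_trans)
      show False
        using s g1(4)[OF h'(1,3,4), of s] g2(4)[OF h'(1,2,4), of s] by (cases "X x") auto
    qed
    ultimately show ?thesis by blast
  next
    case False
    then have ex: "\<exists>N. large g m a c 0 x N \<or> large g m a c 1 x N" for x by blast
    \<comment> \<open>The first stage with a large answer can be searched for, so \<open>i\<close>
      is a computable candidate for a separator; if both answers are large there, it takes
      1.\<close>
    define p where "p x = (LEAST N. large g m a c 0 x N \<or> large g m a c 1 x N)" for x
    define i where "i x = (of_bool (large g m a c 1 x (p x)) :: nat)" for x
    have p: "computable p"
      unfolding p_def
      by (rule computable_Least[OF _ ex]) (intro computable_intros decidable_large gn)
    have "computable i" unfolding i_def by (intro computable_intros decidable_large gn p)
    then obtain s x where sx: "(fst_first u s x \<and> i x \<noteq> 1) \<or> (snd_first u s x \<and> i x = 1)"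
      using no_computable_separator[OF U u] by blast
    define N where "N = p x"
    have "large g m a c 0 x N \<or> large g m a c 1 x N"
      unfolding N_def p_def by (rule LeastI_ex[OF ex])
    then have "large g m a c (i x) x N" by (auto simp: i_def N_def)
    \<comment> \<open>Largeness is applied to the bound \<open>v = g\<close>.\<close>
    then have mN: "m < N" and "\<exists>w. (\<forall>n<m. w n = g n) \<and> (\<forall>n. m \<le> n \<and> n < N \<longrightarrow> w n \<le> g n) \<and>
        weight w m N \<le> 8 * \<delta> \<and> run w N c x = Suc (i x)"
      unfolding large_def \<delta>(1)[symmetric] using gn m(2) by auto
    then obtain w where w: "\<And>n. n < m \<Longrightarrow> w n = g n" "\<And>n. m \<le> n \<Longrightarrow> n < N \<Longrightarrow> w n \<le> g n"
      "weight w m N \<le> 8 * \<delta>" "run w N c x = Suc (i x)" by blast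
    \<comment> \<open>Fixing the oracle up to \<open>N\<close> as \<open>w\<close> makes the wrong
      answer \<open>i x\<close> permanent, by the use principle.\<close>
    define g' where "g' n = (if n < N then w n else g n)" for n
    have g'g: "g' n \<le> g n" for n
      using w(1,2)[of n] by (cases "n < m") (auto simp: g'_def)
    have "condition g' N (2 * \<delta>)"
    proof -
      have "weight g' N M = weight g N M" for M by (rule weight_cong) (simp add: g'_def)
      moreover have "weight g N M \<le> weight g m M" for M using mN by (intro weight_subset) auto
      ultimately have "weight g' N M \<le> \<delta>" for M using m(2)[of M] by (metis order_trans)
      then show ?thesis
        unfolding condition_def using \<delta>(3) g'g gn
        by (intro conjI exI[of _ \<delta>]) (auto intro: order_trans)
    qed
    moreover have "refines g' N (2 * \<delta>) g l e"
    proof -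
      have "weight g' l N = weight g' l m + weight g' m N" using m(1) mN by (intro weight_append) auto
      also have "weight g' l m = weight g l m" using mN w(1) by (intro weight_cong) (simp add: g'_def)
      also have "weight g' m N = weight w m N" by (intro weight_cong) (simp add: g'_def)
      finally have "weight g' l N + 2 * \<delta> \<le> e" using r(2)[of m] w(3) \<delta>(2,3) by linarith
      moreover have "g' n = g n" if "n < l" for n using that w(1) m(1) mN by (simp add: g'_def)
      ultimately show ?thesis unfolding refines_def using m(1) mN g'g by simp
    qed
    moreover have "\<not> (\<forall>n. \<exists>s. run h s c n = Suc (of_bool (X n)))"
      if h: "admits g' N (2 * \<delta>) h" and X: "X \<in> separators u" for h X
    proof
      assume "\<forall>n. \<exists>s. run h s c n = Suc (of_bool (X n))"
      then obtain t where t: "run h t c x = Suc (of_bool (X x))" by blast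
      have "run h N c x = run w N c x" using h by (intro run_cong) (simp add: admits_def g'_def)
      then have "run h N c x = Suc (i x)" using w(4) by simp
      then have "run h (max N t) c x = Suc (i x)" by (rule run_mono_Suc) simp
      moreover have "run h (max N t) c x = Suc (of_bool (X x))" using t by (rule run_mono_Suc) simp
      ultimately have "i x = of_bool (X x)" by simp
      moreover have "(fst_first u s x \<longrightarrow> X x) \<and> (snd_first u s x \<longrightarrow> \<not> X x)"
        using X by (simp add: separators_def)
      ultimately show False using sx by auto
    qed
    ultimately show ?thesis by blast
  qed
qed

lemma initial_condition:
  assumes "prefix_free_machine U"
  shows "\<exists>g. condition g 0 4 \<and> (\<forall>n. enat (g n) \<le> prefix_K U n)"
proof -
  \<comment> \<open>The option \<open>k = n\<close> makes the minimum exist even for numbers without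
    a description.\<close>
  define Q where "Q n k \<longleftrightarrow> k = n \<or> (\<exists>\<tau>. U \<tau> = Some (string_of_nat n) \<and> length \<tau> = k)" for n k
  define g where "g n = (LEAST k. Q n k)" for n
  have Q: "Q n (g n)" for n unfolding g_def by (rule LeastI[of _ n]) (simp add: Q_def)
  have le: "Q n k \<Longrightarrow> g n \<le> k" for n k unfolding g_def by (rule Least_le)
  have gn: "g n \<le> n" for n by (rule le) (simp add: Q_def)
  have K: "enat (g n) \<le> prefix_K U n" for n
    unfolding prefix_K_def machine_complexity_def
    by (rule INF_greatest) (auto intro!: le simp: Q_def)
  define \<tau> where "\<tau> n = (SOME \<tau>. U \<tau> = Some (string_of_nat n) \<and> length \<tau> = g n)" for n
  have \<tau>: "U (\<tau> n) = Some (string_of_nat n) \<and> length (\<tau> n) = g n" if "g n \<noteq> n" for n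
  proof -
    have "\<exists>\<tau>. U \<tau> = Some (string_of_nat n) \<and> length \<tau> = g n" using Q[of n] that by (simp add: Q_def)
    then show ?thesis unfolding \<tau>_def by (rule someI_ex)
  qed
  \<comment> \<open>The values \<open>g n = n\<close> contribute at most 2 as a geometric sum, the
    lengths of descriptions at most 1 by Kraft's inequality.\<close>
  have "weight g 0 N \<le> 3" for N
  proof -
    let ?A = "{n. n < N \<and> g n \<noteq> n}"
    have inj: "inj_on \<tau> ?A"
    proof (rule inj_onI)
      fix n k assume "n \<in> ?A" "k \<in> ?A" "\<tau> n = \<tau> k"
      then have "string_of_nat n = string_of_nat k" using \<tau>[of n] \<tau>[of k] by simp
      then show "n = k" by (metis string_of_nat_inverse(2))
    qed
    have "weight g 0 N \<le> (\<Sum>n=0..<N. (1/2) ^ n + (if g n \<noteq> n then (1/2) ^ g n else 0))"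
      unfolding weight_def by (rule sum_mono) auto
    also have "\<dots> = (\<Sum>n<N. (1/2) ^ n) + (\<Sum>n\<in>?A. (1/2) ^ g n)"
      by (simp add: sum.distrib sum.If_cases atLeast0LessThan Int_def)
    also have "(\<Sum>n\<in>?A. (1/2::real) ^ g n) = (\<Sum>n\<in>?A. (1/2) ^ length (\<tau> n))"
      by (rule sum.cong) (auto simp: \<tau>)
    also have "\<dots> = (\<Sum>\<sigma>\<in>\<tau> ` ?A. (1/2) ^ length \<sigma>)" using inj by (simp add: sum.reindex)
    also have "\<dots> \<le> 1"
    proof (rule kraft_inequality)
      fix \<sigma> \<rho> assume "\<sigma> \<in> \<tau> ` ?A" "\<rho> \<in> \<tau> ` ?A" "prefix \<sigma> \<rho>"
      moreover have "\<tau> ` ?A \<subseteq> dom U" using \<tau> by auto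
      ultimately have "\<sigma> \<in> dom U" "\<rho> \<in> dom U" by (auto simp del: domIff)
      then show "\<sigma> = \<rho>" using assms \<open>prefix \<sigma> \<rho>\<close> by (simp add: prefix_free_machine_def del: domIff)
    qed simp
    also have "(\<Sum>n<N. (1/2::real) ^ n) \<le> 2" by (simp add: sum_gp_strict)
    finally show ?thesis by simp
  qed
  then have "condition g 0 4" unfolding condition_def using gn by (intro conjI exI[of _ 3]) auto
  then show ?thesis using K by blast
qed

section \<open>The limit of a sequence of conditions, one for each oracle program\<close>

theorem theorem3p2:
  fixes U :: "bool list \<Rightarrow> bool list option"
  assumes "optimal_prefix_free_machine U"
  shows "\<exists>f :: nat \<Rightarrow> nat.
    (\<forall>n. enat (f n) \<le> prefix_K U n) \<and>
    summable (\<lambda>n. 2 powr (- real (f n))) \<and>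
    \<not> has_PA_degree f"
proof -
  have pfm: "prefix_free_machine U" using assms by (simp add: optimal_prefix_free_machine_def)
  then have "partrec_in {} (\<lambda>n. map_option nat_of_string (U (string_of_nat n)))"
    by (simp add: prefix_free_machine_def partial_computable_string_fun_def)
  from partrec_in_run[OF this, of "\<lambda>_. 0"] obtain u where
    u: "\<And>n v. map_option nat_of_string (U (string_of_nat n)) = Some v \<Longrightarrow>
      \<exists>s. run (\<lambda>_. 0) s u n = Suc v" by blast
  obtain g where g: "condition g 0 4" "\<And>n. enat (g n) \<le> prefix_K U n"
    using initial_condition[OF pfm] by blast
  define C where "C = (\<lambda>(g, l, e). condition g l e)"
  define step where "step k = (\<lambda>(g, l, e) (g', l', e'). refines g' l' e' g l e \<and>
    (\<forall>h X. admits g' l' e' h \<and> X \<in> separators u \<longrightarrow>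
      \<not> (\<forall>n. \<exists>s. run h s (from_nat k) n = Suc (of_bool (X n)))))" for k
  \<comment> \<open>The clause for \<open>k = 0\<close> is carried along so that dependent choice
    starts from the initial condition.\<close>
  have "\<exists>S. \<forall>k. (C (S k) \<and> (k = 0 \<longrightarrow> S k = (g, 0, 4))) \<and> step k (S k) (S (Suc k))"
  proof (rule dependent_nat_choice)
    show "\<exists>S. C S \<and> (0 = (0::nat) \<longrightarrow> S = (g, 0, 4))" using g by (auto simp: C_def)
    fix S and k :: nat assume "C S \<and> (k = 0 \<longrightarrow> S = (g, 0, 4))"
    then have "condition (fst S) (fst (snd S)) (snd (snd S))" by (auto simp: C_def)
    from force_no_separator[OF assms u this, of "from_nat k"]
    obtain g' l' e' where "C (g', l', e')" "step k S (g', l', e')"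
      unfolding C_def step_def case_prod_beta fst_conv snd_conv by blast
    then show "\<exists>S'. (C S' \<and> (Suc k = 0 \<longrightarrow> S' = (g, 0, 4))) \<and> step k S S'" by blast
  qed
  then obtain S where S: "\<And>k. C (S k) \<and> (k = 0 \<longrightarrow> S k = (g, 0, 4)) \<and> step k (S k) (S (Suc k))"
    by auto
  define G where "G k = fst (S k)" for k
  define L where "L k = fst (snd (S k))" for k
  define E where "E k = snd (snd (S k))" for k
  have S_eq: "S k = (G k, L k, E k)" for k by (simp add: G_def L_def E_def)
  have S0: "G 0 = g" "L 0 = 0" "E 0 = 4" using S[of 0] by (auto simp: S_eq)
  have cond: "condition (G k) (L k) (E k)" for k using S[of k] by (simp add: S_eq C_def)
  have ref: "refines (G (Suc k)) (L (Suc k)) (E (Suc k)) (G k) (L k) (E k)" for k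
    using S[of k] by (simp add: S_eq step_def)
  have avoid: "\<not> (\<forall>n. \<exists>s. run h s (from_nat k) n = Suc (of_bool (X n)))"
    if "admits (G (Suc k)) (L (Suc k)) (E (Suc k)) h" "X \<in> separators u" for k h X
    using S[of k] that by (simp add: S_eq step_def)
  have E_nonneg: "0 \<le> E k" for k
    using cond[of k] unfolding condition_def by (meson weight_nonneg order_trans less_imp_le)
  have L_ge: "k \<le> L k" for k
    using ref by (induction k) (auto simp: refines_def intro: order_trans less_le_trans Suc_leI le_less_trans)
  have adm: "admits (G k) (L k) (E k) (G (k + j))" for k j
  proof -
    have "admits (G k) (L k) (E k) h" if "admits (G (k + j)) (L (k + j)) (E (k + j)) h" for h
      using that
    proof (induction j)
      case (Suc j)
      then show ?case using refines_admits[OF ref _ E_nonneg] by simp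
    qed simp
    then show ?thesis using condition_admits_self[OF cond] by blast
  qed
  \<comment> \<open>Since \<open>n < L (Suc n)\<close>, the value at \<open>n\<close> no longer
    changes from condition \<open>Suc n\<close> on.\<close>
  define f where "f n = G (Suc n) n" for n
  have f: "G j n = f n" if "n < j" for j n
  proof -
    have "n < L (Suc n)" using L_ge[of "Suc n"] by simp
    then show ?thesis using adm[of "Suc n" "j - Suc n"] that by (simp add: admits_def f_def)
  qed
  have f_adm: "admits (G k) (L k) (E k) f" for k
    unfolding admits_def
  proof (intro conjI allI impI)
    fix n
    have "G (k + Suc n) n = f n" by (rule f) simp
    then show "n < L k \<Longrightarrow> f n = G k n" "L k \<le> n \<Longrightarrow> f n \<le> G k n"
      using adm[of k "Suc n"] by (auto simp: admits_def)
  next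
    fix N
    \<comment> \<open>A partial sum of \<open>f\<close> is one of a sufficiently late bound, which
      condition \<open>k\<close> admits.\<close>
    have "weight f (L k) N = weight (G (k + N)) (L k) N" by (rule weight_cong) (simp add: f)
    then show "weight f (L k) N \<le> E k" using adm[of k N] by (simp add: admits_def)
  qed
  have f0: "f n \<le> g n" and wt: "weight f 0 N \<le> 4" for n N
    using f_adm[of 0] by (auto simp: admits_def S0)
  show ?thesis
  proof (intro exI[of _ f] conjI allI)
    show "enat (f n) \<le> prefix_K U n" for n
      using f0[of n] g(2)[of n] by (meson enat_ord_simps(1) order_trans)
    have "summable (\<lambda>n. (1/2::real) ^ f n)"
      using wt by (intro summableI_nonneg_bounded[of _ 4]) (auto simp: weight_def atLeast0LessThan)
    moreover have "2 powr (- real k) = (1/2) ^ k" for k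
      by (simp add: powr_minus powr_realpow power_one_over inverse_eq_divide)
    ultimately show "summable (\<lambda>n. 2 powr (- real (f n)))" by simp
    show "\<not> has_PA_degree f"
    proof
      assume "has_PA_degree f"
      then obtain X where X: "X \<in> separators u" "computes f X"
        using Pi01_class_separators_prog separators_nonempty unfolding has_PA_degree_def by blast
      obtain c where "\<forall>n. \<exists>s. run f s c n = Suc (of_bool (X n))"
        using partrec_in_run[OF X(2)[unfolded computes_def] order_refl] by blast
      then show False using avoid[OF f_adm X(1), of "to_nat c"] by simp
    qed
  qed
qed

end
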